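(* Let $\mathfrak X$ be an Ahlfors-regular uniform grid model (with parameter $L\ge 2$), and let $S_0\supset S_1\supset S_2\supset\cdots$ be the associated random sets. Then almost surely \[ \lim_{n\to\infty}\frac{\operatorname{Fav}(S_n)}{\mathbb{E}\operatorname{Fav}(S_n)}=1 . \]
   Context: Fix an integer $L\ge 2$ and let $\mathcal{D}_n$ denote the set of $L^{-n}\times L^{-n}$ closed squares obtained by dividing $[0,1]^2$ into an $L^n\times L^n$ grid. A grid model is given by a probability distribution $\mathfrak X$ on finite subsets of $\mathcal{D}_1$ (a random collection of distinct squares $Q_1,\dots,Q_{\mathbf L}$ from $\mathcal{D}_1$, with $\mathbf L$ random) satisfying $\mathbb{E}[\mathbf L]=L$. The random sets are constructed as follows: $\mathcal{S}_0=\{[0,1]^2\}$, $S_0=[0,1]^2$; given $\mathcal{S}_n$, for each square $R\in\mathcal{S}_n$ take an independent realization of $\mathfrak X$ (independent also of $\mathcal{S}_n$) and map the chosen squares into $R$ by the natural homothety $[0,1]^2\to R$; $\mathcal{S}_{n+1}$ is the collection of all resulting squares and $S_{n+1}=\bigcup\mathcal{S}_{n+1}$. The model is Ahlfors-regular if $\mathbf L$ is almost surely constant (so $\mathbf L=L$ a.s.). The model is uniform if $\mathbb{P}[Q\in\mathcal{S}_1]=1/L$ for every $Q\in\mathcal{D}_1$. For a Borel set $A\subset\mathbb{R}^2$, $\operatorname{Fav}(A)=\int_0^\pi|\operatorname{proj}_\theta A|\,d\theta$, where $\operatorname{proj}_\theta(x)=\langle x,(-\sin\theta,\cos\theta)\rangle$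 and $|\cdot|$ is one-dimensional Lebesgue measure. *)

theory Defs
  imports "HOL-Probability.Probability"
begin

definition grid_sq :: "nat \<Rightarrow> nat \<Rightarrow> nat \<times> nat \<Rightarrow> (real \<times> real) set" where
  "grid_sq L n ij = cbox (real (fst ij) / real L ^ n, real (snd ij) / real L ^ n)
                         ((real (fst ij) + 1) / real L ^ n, (real (snd ij) + 1) / real L ^ n)"

definition grid_model :: "nat \<Rightarrow> (nat \<times> nat) set pmf \<Rightarrow> bool" where
  "grid_model L X \<longleftrightarrow> (\<forall>A \<in> set_pmf X. A \<subseteq> {..<L} \<times> {..<L}) \<and>
     measure_pmf.expectation X (\<lambda>A. real (card A)) = real L"

definition ahlfors_regular :: "nat \<Rightarrow> (nat \<times> nat) set pmf \<Rightarrow> bool" where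
  "ahlfors_regular L X \<longleftrightarrow> (AE A in measure_pmf X. card A = L)"

definition uniform_model :: "nat \<Rightarrow> (nat \<times> nat) set pmf \<Rightarrow> bool" where
  "uniform_model L X \<longleftrightarrow>
     (\<forall>Q \<in> {..<L} \<times> {..<L}. measure_pmf.prob X {A. Q \<in> A} = 1 / real L)"

text \<open>Probability space: one independent realization of X for every square (n,i,j) of D_n.\<close>
definition grid_space :: "(nat \<times> nat) set pmf \<Rightarrow> (nat \<times> nat \<times> nat \<Rightarrow> (nat \<times> nat) set) measure" where
  "grid_space X = PiM UNIV (\<lambda>_. measure_pmf X)"

fun sel :: "nat \<Rightarrow> (nat \<times> nat \<times> nat \<Rightarrow> (nat \<times> nat) set) \<Rightarrow> nat \<Rightarrow> (nat \<times> nat) set" where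
  "sel L \<omega> 0 = {(0, 0)}"
| "sel L \<omega> (Suc n) = {(L * i + a, L * j + b) | i j a b. (i, j) \<in> sel L \<omega> n \<and> (a, b) \<in> \<omega> (n, i, j)}"

definition rand_set :: "nat \<Rightarrow> (nat \<times> nat \<times> nat \<Rightarrow> (nat \<times> nat) set) \<Rightarrow> nat \<Rightarrow> (real \<times> real) set" where
  "rand_set L \<omega> n = (\<Union>ij \<in> sel L \<omega> n. grid_sq L n ij)"

definition proj_theta :: "real \<Rightarrow> real \<times> real \<Rightarrow> real" where
  "proj_theta \<theta> x = - sin \<theta> * fst x + cos \<theta> * snd x"

definition Fav :: "(real \<times> real) set \<Rightarrow> real" where
  "Fav A = (LBINT \<theta>=0..pi. measure lborel (proj_theta \<theta> ` A))"

end

theory Submission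
  imports Defs "HOL-Real_Asymp.Real_Asymp"
begin

text \<open>Write \<open>X\<^sub>n = Fav (S\<^sub>n)\<close> and \<open>m\<^sub>n\<close> for its mean. The pieces of \<open>S\<^sub>n\<close> in the \<open>L\<^sup>k\<close> squares
  of \<open>S\<^sub>k\<close> are independent copies of \<open>S\<close> at generation \<open>n - k\<close>, shrunk by \<open>L\<^sup>k\<close>. Hence \<open>X\<^sub>n\<close> is at most the
  average of \<open>L\<^sup>k\<close> independent copies of \<open>X\<close> at generation \<open>n - k\<close>, whose mean is \<open>m\<close> at \<open>n - k\<close> and whose
  variance is smaller by the factor \<open>L\<^sup>k\<close>. The nonnegative defect for \<open>k = 1\<close> measures the overlap of
  the projections of the level-one pieces, which decreases pathwise with \<open>n\<close>; so \<open>m\<close> is convex.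
  An energy estimate gives the deterministic bound \<open>X\<^sub>n \<ge> c / (n + 1)\<close>. A decreasing convex sequence with
  such a lower bound satisfies \<open>m\<^sub>n\<^sub>+\<^sub>1 / m\<^sub>n \<rightarrow> 1\<close>, quantitatively enough to make
  \<open>E \<bar>X\<^sub>n - m\<^sub>n\<bar> / m\<^sub>n\<close> summable along the first times at which \<open>m\<close> falls below the
  powers of any \<open>q < 1\<close>. Monotonicity of \<open>X\<^sub>n\<close> fills the gaps.\<close>

section \<open>Convex sequences with a harmonic lower bound\<close>

text \<open>No rate of decay is known for \<open>m\<close>, so every estimate is relative to
  \<open>m n\<close>. Averaging over k generations shrinks the fluctuation by the factor
  \<open>(1 / sqrt 2) ^ k\<close> but costs the drop \<open>m (n - k) - m n\<close>. The quantity
  \<open>\<beta> n\<close> bounds the relative drop per step, up to the factor 4, and k of order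
  \<open>1 / sqrt (\<beta> n)\<close> makes both errors of order \<open>sqrt (\<beta> n)\<close>.
  Since \<open>\<beta> n\<close> is at least \<open>1 / (n + 1)\<close>, these errors are never
  summable over all n; this forces the passage to sparse times. The harmonic bound enters twice: it
  makes \<beta> tend to 0, and it caps the terms of the series along the sparse times. If
  \<open>m\<close> has a positive limit, small thresholds are never crossed; then convergence in
  mean together with pathwise monotonicity suffices. The domination by averages is one-sided, but
  since the mean of the difference is known it still controls absolute deviations.\<close>

lemma sum_inverse_powers_le:
  fixes r B :: real
  assumes "finite A" "0 < r" "r < 1" "0 \<le> B" "\<And>j. j \<in> A \<Longrightarrow> (1 / r) ^ j \<le> B"
  shows "(\<Sum>j\<in>A. (1 / r) ^ j) \<le> B / (1 - r)"
proof (cases "A = {}")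
  case False
  define J where "J = Max A"
  have J: "J \<in> A" "\<And>j. j \<in> A \<Longrightarrow> j \<le> J"
    using assms(1) False by (auto simp: J_def)
  have "(\<Sum>j\<in>A. (1 / r) ^ j) \<le> (\<Sum>j\<le>J. (1 / r) ^ j)"
    using assms J by (intro sum_mono2) auto
  \<comment> \<open>Counted down from the largest exponent, the terms are the largest one times the
    powers of r, so their number does not matter.\<close>
  also have "\<dots> = (\<Sum>j\<le>J. (1 / r) ^ (J - j))"
    by (rule sum.reindex_bij_witness[of _ "\<lambda>j. J - j" "\<lambda>j. J - j"]) auto
  also have "\<dots> = (1 / r) ^ J * (\<Sum>j\<le>J. r ^ j)"
    unfolding sum_distrib_left using assms(2)
    by (intro sum.cong refl) (auto simp: power_diff field_simps)
  also have "\<dots> \<le> B * (1 / (1 - r))"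
  proof (intro mult_mono)
    have "(\<Sum>j\<le>J. r ^ j) \<le> (\<Sum>j. r ^ j)"
      using assms by (intro sum_le_suminf summable_geometric) auto
    also have "\<dots> = 1 / (1 - r)"
      using assms by (intro suminf_geometric) auto
    finally show "(\<Sum>j\<le>J. r ^ j) \<le> 1 / (1 - r)" .
  qed (use assms J in \<open>auto intro!: sum_nonneg\<close>)
  finally show ?thesis by simp
qed (use assms in auto)

locale convex_decay =
  fixes m :: "nat \<Rightarrow> real" and c :: real
  assumes c_pos: "0 < c"
    and lower: "\<And>n. c / (real n + 1) \<le> m n"
    and decreasing: "\<And>n. m (Suc n) \<le> m n"
    and convex: "\<And>n. m (Suc n) - m (Suc (Suc n)) \<le> m n - m (Suc n)"
begin

text \<open>Up to the factor 4, a bound for the relative decrease of \<open>m\<close> per step near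
  n. The index \<open>n div 4\<close> comes from halving twice: a drop over k steps with
  \<open>2 * k \<le> n\<close> is governed by the step at \<open>n div 2\<close>, and that step by
  the value of \<open>m\<close> at half of \<open>n div 2\<close>.\<close>

definition \<beta> :: "nat \<Rightarrow> real" where "\<beta> n = m (n div 4) / ((real n + 1) * m n)"

lemma m_pos: "0 < m n"
proof -
  have "0 < c / (real n + 1)" using c_pos by simp
  then show ?thesis using lower[of n] by linarith
qed

lemma m_antimono: "i \<le> j \<Longrightarrow> m j \<le> m i"
  using decreasing by (rule lift_Suc_antimono_le)

lemma step_antimono: "i \<le> j \<Longrightarrow> m j - m (Suc j) \<le> m i - m (Suc i)"
  by (rule lift_Suc_antimono_le[of "\<lambda>n. m n - m (Suc n)"]) (use convex in auto)

lemma drop_ge: "real k * (m (h + k) - m (Suc (h + k))) \<le> m h - m (h + k)"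
proof (induction k)
  case (Suc k)
  have "real (Suc k) * (m (h + Suc k) - m (Suc (h + Suc k)))
      \<le> real (Suc k) * (m (h + k) - m (Suc (h + k)))"
    using step_antimono[of "h + k" "h + Suc k"] by (intro mult_left_mono) auto
  also have "\<dots> \<le> m h - m (h + Suc k)" using Suc by (simp add: algebra_simps)
  finally show ?case .
qed simp

lemma drop_le: "m h - m (h + k) \<le> real k * (m h - m (Suc h))"
proof (induction k)
  case (Suc k)
  then show ?case using step_antimono[of h "h + k"] by (simp add: algebra_simps)
qed simp

text \<open>By convexity each step between \<open>n div 2\<close> and n is at least the step at n,
  and by positivity these steps add up to at most \<open>m (n div 2)\<close>. Counting the step at n
  itself gives \<open>k + 1\<close> of them, hence the denominator.\<close>

lemma step_le: "m n - m (Suc n) \<le> 2 * m (n div 2) / (real n + 1)"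
proof -
  define h k where "h = n div 2" and "k = n - h"
  have n: "n = h + k" by (simp add: h_def k_def)
  have "real k * (m n - m (Suc n)) \<le> m h - m n"
    using drop_ge[of k h] by (simp add: n)
  then have "(real k + 1) * (m n - m (Suc n)) \<le> m h"
    using m_pos[of "Suc n"] by (simp add: algebra_simps)
  moreover have "(real n + 1) / 2 \<le> real k + 1"
  proof -
    have "n + 1 \<le> 2 * (k + 1)" unfolding k_def h_def by simp
    then have "real (n + 1) \<le> real (2 * (k + 1))" by (rule of_nat_mono)
    then show ?thesis by simp
  qed
  moreover have "0 \<le> m n - m (Suc n)" using decreasing[of n] by simp
  ultimately have "(real n + 1) / 2 * (m n - m (Suc n)) \<le> m h"
    by (meson mult_right_mono order_trans)
  then show ?thesis by (simp add: h_def field_simps)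
qed

lemma drop_le_beta:
  assumes "2 * k \<le> n"
  shows "m (n - k) - m n \<le> 4 * real k * \<beta> n * m n"
proof -
  have "m (n - k) - m n \<le> real k * (m (n - k) - m (Suc (n - k)))"
    using drop_le[of "n - k" k] assms by simp
  also have "\<dots> \<le> real k * (m (n div 2) - m (Suc (n div 2)))"
    using assms by (intro mult_left_mono step_antimono) auto
  also have "\<dots> \<le> real k * (2 * m (n div 2 div 2) / (real (n div 2) + 1))"
    by (intro mult_left_mono step_le) auto
  also have "\<dots> \<le> real k * (2 * m (n div 4) / ((real n + 1) / 2))"
  proof -
    have "n + 1 \<le> 2 * (n div 2 + 1)" by simp
    then have "real (n + 1) \<le> real (2 * (n div 2 + 1))" by (rule of_nat_mono)
    then have "(real n + 1) / 2 \<le> real (n div 2) + 1" by simp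
    moreover have "n div 2 div 2 = n div 4" by simp
    ultimately show ?thesis using m_pos[of "n div 4"]
      by (intro mult_left_mono frac_le) auto
  qed
  also have "\<dots> = 4 * real k * \<beta> n * m n"
  proof -
    have "\<beta> n * m n = m (n div 4) / (real n + 1)" using m_pos[of n] by (simp add: \<beta>_def)
    then show ?thesis by (simp add: mult.assoc)
  qed
  finally show ?thesis .
qed

lemma beta_ge: "1 / (real n + 1) \<le> \<beta> n"
proof -
  have "m n \<le> m (n div 4)" by (intro m_antimono) simp
  then have "1 / ((real n + 1) * m n) * m n \<le> 1 / ((real n + 1) * m n) * m (n div 4)"
    using m_pos[of n] by (intro mult_left_mono) auto
  then show ?thesis using m_pos[of n] by (simp add: \<beta>_def)
qed

lemma beta_pos: "0 < \<beta> n"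
  using beta_ge[of n] by (smt (verit) divide_pos_pos of_nat_0_le_iff)

lemma filterlim_div_4: "filterlim (\<lambda>n::nat. n div 4) at_top at_top"
  unfolding filterlim_at_top
proof
  fix Z :: nat
  show "\<forall>\<^sub>F n in at_top. Z \<le> n div 4"
    using eventually_ge_at_top[of "4 * Z"] by eventually_elim auto
qed

lemma m_convergent: obtains l where "m \<longlonglongrightarrow> l" "0 \<le> l" "\<And>n. l \<le> m n"
proof -
  have "decseq m" using m_antimono by (auto simp: decseq_def)
  then obtain l where l: "m \<longlonglongrightarrow> l" "\<forall>i. l \<le> m i"
    using decseq_convergent[of m 0] m_pos by (metis less_imp_le)
  moreover have "0 \<le> l" using l(1) m_pos by (intro LIMSEQ_le_const) (auto intro: less_imp_le)
  ultimately show ?thesis using that by blast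
qed

lemma beta_le: "\<beta> n \<le> m (n div 4) / c"
proof -
  have "c \<le> (real n + 1) * m n" using lower[of n] by (simp add: field_simps)
  then show ?thesis unfolding \<beta>_def using c_pos m_pos[of "n div 4"] m_pos[of n]
    by (intro divide_left_mono) auto
qed

text \<open>The harmonic bound keeps the denominator of \<beta> above c, so a vanishing limit of
  \<open>m\<close> suffices. If the limit is positive, \<open>m\<close> is bounded above and below
  and the factor n + 1 does the work.\<close>

lemma beta_tendsto: "\<beta> \<longlonglongrightarrow> 0"
proof -
  obtain l where l: "m \<longlonglongrightarrow> l" "0 \<le> l" "\<And>n. l \<le> m n" using m_convergent by blast
  show ?thesis
  proof (cases "l = 0")
    case True
    have lim: "(\<lambda>n. m (n div 4) / c) \<longlonglongrightarrow> 0 / c"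
      using filterlim_compose[OF l(1) filterlim_div_4] True c_pos by (intro tendsto_divide) auto
    then have lim: "(\<lambda>n. m (n div 4) / c) \<longlonglongrightarrow> 0" by simp
    show ?thesis
      by (rule tendsto_sandwich[OF _ _ tendsto_const lim])
        (use beta_le beta_pos in \<open>auto simp: less_imp_le\<close>)
  next
    case False
    have le: "\<beta> n \<le> m 0 / l * (1 / (real n + 1))" for n
    proof -
      have "m (n div 4) / ((real n + 1) * m n) \<le> m 0 / ((real n + 1) * l)"
        using False l m_pos m_antimono[of 0 "n div 4"] by (intro frac_le mult_left_mono mult_pos_pos) (auto intro: less_imp_le)
      then show ?thesis by (simp add: \<beta>_def field_simps)
    qed
    have "(\<lambda>n. m 0 / l * (1 / (real n + 1))) \<longlonglongrightarrow> m 0 / l * 0"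
      by (intro tendsto_mult tendsto_const) real_asymp
    then have lim: "(\<lambda>n. m 0 / l * (1 / (real n + 1))) \<longlonglongrightarrow> 0" by simp
    show ?thesis
      by (rule tendsto_sandwich[OF _ _ tendsto_const lim])
        (use le beta_pos in \<open>auto simp: less_imp_le\<close>)
  qed
qed

lemma ratio_bounds: "1 / (1 + 4 * \<beta> (Suc n)) \<le> m (Suc n) / m n" if "1 \<le> n"
proof -
  have "m n \<le> (1 + 4 * \<beta> (Suc n)) * m (Suc n)"
    using drop_le_beta[of 1 "Suc n"] that by (simp add: algebra_simps)
  then show ?thesis using beta_pos[of "Suc n"] m_pos[of n] m_pos[of "Suc n"]
    by (simp add: field_simps add_pos_pos)
qed

lemma ratio_tendsto: "(\<lambda>n. m (Suc n) / m n) \<longlonglongrightarrow> 1"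
proof -
  have "(\<lambda>n. 1 / (1 + 4 * \<beta> (Suc n))) \<longlonglongrightarrow> 1 / (1 + 4 * 0)"
    by (intro tendsto_intros LIMSEQ_Suc beta_tendsto) auto
  then have lim: "(\<lambda>n. 1 / (1 + 4 * \<beta> (Suc n))) \<longlonglongrightarrow> 1" by simp
  show ?thesis
  proof (rule tendsto_sandwich[OF _ _ lim tendsto_const])
    show "\<forall>\<^sub>F n in sequentially. 1 / (1 + 4 * \<beta> (Suc n)) \<le> m (Suc n) / m n"
      using eventually_ge_at_top[of 1] by eventually_elim (rule ratio_bounds)
    show "\<forall>\<^sub>F n in sequentially. m (Suc n) / m n \<le> 1"
      using decreasing m_pos by (simp add: field_simps)
  qed
qed

text \<open>The recursion halves the old second moment, whereas \<open>(m n)\<^sup>2\<close>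
  eventually shrinks by no more than the factor 4 / 5 per step, because consecutive means have ratio
  tending to 1. So the quotient of the two stays bounded.\<close>

lemma second_moment_le:
  fixes e :: "nat \<Rightarrow> real"
  assumes rec: "\<And>n. e (Suc n) \<le> (m n)\<^sup>2 + e n / 2"
  obtains K where "0 < K" "\<And>n. e n \<le> K * (m n)\<^sup>2"
proof -
  have "\<forall>\<^sub>F n in sequentially. 9 / 10 < m (Suc n) / m n"
    using ratio_tendsto by (rule order_tendstoD) simp
  then obtain N where N: "\<And>n. N \<le> n \<Longrightarrow> 9 / 10 < m (Suc n) / m n"
    by (auto simp: eventually_sequentially)
  have step: "(m n)\<^sup>2 \<le> 5 / 4 * (m (Suc n))\<^sup>2" if "N \<le> n" for n
  proof -
    have "9 / 10 * m n \<le> m (Suc n)" using N[OF that] m_pos[of n] by (simp add: field_simps)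
    then have "(9 / 10 * m n)\<^sup>2 \<le> (m (Suc n))\<^sup>2" using m_pos[of n] by (intro power_mono) auto
    then have "81 / 100 * (m n)\<^sup>2 \<le> (m (Suc n))\<^sup>2"
      by (simp add: power_mult_distrib power_divide)
    moreover have "0 \<le> (m (Suc n))\<^sup>2" by simp
    ultimately show ?thesis by linarith
  qed
  \<comment> \<open>The induction step needs \<open>(1 + K / 2) * (5 / 4) \<le> K\<close>, that is,
    K at least 10 / 3. The maximum absorbs the finitely many indices up to N.\<close>
  define K where "K = Max (insert 4 ((\<lambda>n. e n / (m n)\<^sup>2) ` {..N}))"
  have K4: "4 \<le> K" and KN: "\<And>n. n \<le> N \<Longrightarrow> e n / (m n)\<^sup>2 \<le> K"
    by (auto simp: K_def simp del: Max_insert intro!: Max_ge)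
  have "e n \<le> K * (m n)\<^sup>2" for n
  proof (cases "n \<le> N")
    case True
    then show ?thesis using KN[OF True] m_pos[of n] by (simp add: field_simps)
  next
    case False
    then have "N \<le> n" by simp
    then show ?thesis
    proof (induction n rule: dec_induct)
      case base
      then show ?case using KN[of N] m_pos[of N] by (simp add: field_simps)
    next
      case (step n)
      have "e (Suc n) \<le> (1 + K / 2) * (m n)\<^sup>2"
        using rec[of n] step by (simp add: algebra_simps)
      also have "\<dots> \<le> (1 + K / 2) * (5 / 4 * (m (Suc n))\<^sup>2)"
        using K4 \<open>\<And>n. N \<le> n \<Longrightarrow> (m n)\<^sup>2 \<le> 5 / 4 * (m (Suc n))\<^sup>2\<close>[of n] step by (intro mult_left_mono) auto
      also have "\<dots> \<le> K * (m (Suc n))\<^sup>2"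
      proof -
        have "(1 + K / 2) * (5 / 4) \<le> K" using K4 by simp
        from mult_right_mono[OF this zero_le_power2[of "m (Suc n)"]] show ?thesis by (simp only: mult.assoc)
      qed
      finally show ?case .
    qed
  qed
  then show ?thesis using that[of K] K4 by auto
qed

text \<open>Harmonic decay is all that the balance against \<open>real k * \<beta> n\<close> uses.
  The 3 comes from Bernoulli's inequality and \<open>4 / 3 \<le> sqrt 2\<close>.\<close>

lemma half_power_le: "(1 / sqrt 2) ^ k \<le> 3 / (real k + 1)"
proof -
  have s: "4/3 \<le> sqrt 2" by (rule real_le_rsqrt) (simp add: power2_eq_square)
  have "1 + real k * (1 / 3) \<le> (1 + 1 / 3) ^ k" by (rule Bernoulli_inequality) auto
  also have "\<dots> \<le> sqrt 2 ^ k" using s by (intro power_mono) auto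
  finally have "(real k + 1) / 3 \<le> sqrt 2 ^ k" by simp
  then show ?thesis by (simp add: power_divide field_simps)
qed

text \<open>The two errors balance at k about \<open>1 / sqrt (\<beta> n)\<close>: the power is then
  at most \<open>3 * sqrt (\<beta> n)\<close>, multiplied by at most \<open>5 * K * m n\<close>, and
  the drop is at most \<open>4 * sqrt (\<beta> n) * m n\<close>. A logarithmic k would be sharper,
  but the square root is already summable along the passage times.\<close>

lemma deviation_le:
  fixes d :: "nat \<Rightarrow> real"
  assumes "0 < K"
    and d: "\<And>n k. k \<le> n \<Longrightarrow> d n \<le> (1 / sqrt 2) ^ k * (K * m (n - k)) + 2 * (m (n - k) - m n)"
  obtains C where "0 < C" "\<forall>\<^sub>F n in sequentially. d n \<le> C * sqrt (\<beta> n) * m n"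
proof -
  have ev1: "\<forall>\<^sub>F n in sequentially. \<beta> n < 1"
    using beta_tendsto by (rule order_tendstoD) simp
  have "d n \<le> (15 * K + 8) * sqrt (\<beta> n) * m n" if n: "\<beta> n < 1" "8 \<le> n" for n
  proof -
    define b where "b = sqrt (\<beta> n)"
    have b: "0 < b" "b \<le> 1" "\<beta> n = b * b" using beta_pos[of n] n by (auto simp: b_def)
    define k where "k = nat \<lfloor>1 / b\<rfloor>"
    have "0 \<le> 1 / b" using b by simp
    then have k: "real k \<le> 1 / b" "1 / b \<le> real k + 1"
      unfolding k_def by linarith+
    \<comment> \<open>Since \<open>\<beta> n\<close> is at least \<open>1 / (n + 1)\<close>, k is at
      most \<open>sqrt (n + 1)\<close>, which is at most n / 2 once n is at least 8; so
      \<open>drop_le_beta\<close> applies.\<close>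
    have "1 / (b * b) \<le> real n + 1"
      using beta_ge[of n] b by (simp add: field_simps)
    then have "(real k)\<^sup>2 \<le> real n + 1"
      using k(1) b power_mono[of "real k" "1 / b" 2] by (simp add: power2_eq_square power_divide)
    also have "\<dots> \<le> (real n / 2)\<^sup>2"
    proof -
      have "0 \<le> (real n - 8) * real n + 4 * (real n - 1)" using n by (intro add_nonneg_nonneg mult_nonneg_nonneg) auto
      then show ?thesis by (simp add: power2_eq_square algebra_simps)
    qed
    finally have "real k \<le> real n / 2" by (rule power2_le_imp_le) simp
    then have kn: "2 * k \<le> n" by linarith
    then have "k \<le> n" by simp
    have kb: "real k * \<beta> n \<le> b" using k(1) b by (simp add: field_simps)
    have "m (n - k) - m n \<le> 4 * (real k * \<beta> n) * m n" using drop_le_beta[OF kn] by simp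
    also have "\<dots> \<le> 4 * b * m n" using kb m_pos[of n] by (intro mult_right_mono) auto
    finally have drop: "m (n - k) - m n \<le> 4 * b * m n" .
    have "(1 / sqrt 2) ^ k \<le> 3 * b"
    proof -
      have "3 / (real k + 1) \<le> 3 * b" using k(2) b by (simp add: field_simps)
      then show ?thesis using half_power_le[of k] by linarith
    qed
    moreover have "m (n - k) \<le> 5 * m n"
    proof -
      have "4 * b * m n \<le> 4 * m n" using b m_pos[of n] by simp
      then show ?thesis using drop by linarith
    qed
    ultimately have "(1 / sqrt 2) ^ k * (K * m (n - k)) \<le> (3 * b) * (K * (5 * m n))"
      using \<open>0 < K\<close> m_pos[of "n - k"] b by (intro mult_mono) auto
    then have "d n \<le> (3 * b) * (K * (5 * m n)) + 2 * (4 * b * m n)"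
      using drop by (intro order_trans[OF d[OF \<open>k \<le> n\<close>]] add_mono mult_left_mono) auto
    then show ?thesis by (simp add: b_def algebra_simps)
  qed
  note bound = this
  have "\<forall>\<^sub>F n in sequentially. d n \<le> (15 * K + 8) * sqrt (\<beta> n) * m n"
    using ev1 eventually_ge_at_top[of 8] by eventually_elim (rule bound)
  then show ?thesis using that[of "15 * K + 8"] \<open>0 < K\<close> by auto
qed


section \<open>Passage times through geometric levels\<close>

definition level :: "real \<Rightarrow> nat \<Rightarrow> nat" where
  "level q j = (LEAST n. m n \<le> m 0 * q ^ j)"

context
  fixes q :: real
  assumes q: "0 < q" "q < 1" and to_0: "m \<longlonglongrightarrow> 0"
begin

lemma level_le: "m (level q j) \<le> m 0 * q ^ j"
proof -
  have "\<forall>\<^sub>F n in sequentially. m n < m 0 * q ^ j"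
    using to_0 q m_pos[of 0] by (intro order_tendstoD) auto
  then obtain n where "m n < m 0 * q ^ j" by (auto simp: eventually_sequentially)
  then have "m n \<le> m 0 * q ^ j" by simp
  then show ?thesis unfolding level_def by (rule LeastI)
qed

lemma less_level: "n < level q j \<Longrightarrow> m 0 * q ^ j < m n"
  unfolding level_def using not_less_Least by fastforce

lemma level_0 [simp]: "level q 0 = 0"
  unfolding level_def by (rule Least_equality) auto

lemma level_mono: "i \<le> j \<Longrightarrow> level q i \<le> level q j"
proof (rule ccontr)
  assume "i \<le> j" "\<not> level q i \<le> level q j"
  then have "m 0 * q ^ i < m (level q j)" by (intro less_level) simp
  also have "\<dots> \<le> m 0 * q ^ j" by (rule level_le)
  also have "\<dots> \<le> m 0 * q ^ i"
    using q m_pos[of 0] \<open>i \<le> j\<close> by (intro mult_left_mono power_decreasing) auto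
  finally show False by simp
qed

lemma filterlim_level: "filterlim (level q) at_top at_top"
  unfolding filterlim_at_top
proof
  fix Z
  have "(\<lambda>j. m 0 * q ^ j) \<longlonglongrightarrow> m 0 * 0"
    using q by (intro tendsto_intros LIMSEQ_realpow_zero) auto
  then have "\<forall>\<^sub>F j in sequentially. m 0 * q ^ j < m Z"
    using m_pos[of Z] by (intro order_tendstoD[of _ 0]) auto
  then show "\<forall>\<^sub>F j in sequentially. Z \<le> level q j"
  proof eventually_elim
    case (elim j)
    show ?case
    proof (rule ccontr)
      assume "\<not> Z \<le> level q j"
      then have "m Z \<le> m (level q j)" by (intro m_antimono) simp
      then show False using level_le[of j] elim by simp
    qed
  qed
qed

text \<open>One index before the passage time the mean is still above \<open>m 0 * q ^ j\<close>,
  and far out a single step costs at most the factor q; so the overshoot is at most one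
  level.\<close>

lemma level_ge: "\<forall>\<^sub>F j in sequentially. m 0 * q ^ Suc j \<le> m (level q j)"
proof -
  have "\<forall>\<^sub>F n in sequentially. q < m (Suc n) / m n"
    using ratio_tendsto q by (intro order_tendstoD) auto
  then obtain N where N: "\<And>n. N \<le> n \<Longrightarrow> q < m (Suc n) / m n"
    by (auto simp: eventually_sequentially)
  have "\<forall>\<^sub>F j in sequentially. Suc N \<le> level q j"
    using filterlim_level by (auto simp: filterlim_at_top)
  then show ?thesis
  proof eventually_elim
    case (elim j)
    then obtain n where n: "level q j = Suc n" "N \<le> n" by (cases "level q j") auto
    have "m 0 * q ^ j < m n" by (rule less_level) (simp add: n)
    then have "m 0 * q ^ Suc j \<le> q * m n" using q by simp
    also have "\<dots> \<le> m (Suc n)" using N[OF n(2)] m_pos[of n] by (simp add: field_simps)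
    finally show ?case by (simp add: n)
  qed
qed

text \<open>Several j may share a passage time, so the interval is found from the least index whose
  passage time exceeds n; \<open>level_0\<close> makes that index positive. The minimality clause
  later forces the grouping index below the index that is grouped.\<close>

lemma level_interval:
  obtains j where "level q j \<le> n" "n < level q (Suc j)" "\<And>k. n < level q k \<Longrightarrow> j < k"
proof -
  have "\<forall>\<^sub>F j in sequentially. Suc n \<le> level q j"
    using filterlim_level by (auto simp: filterlim_at_top)
  then obtain k where "n < level q k" by (auto simp: eventually_sequentially Suc_le_eq)
  define j where "j = (LEAST j. n < level q j) - 1"
  have *: "n < level q (LEAST j. n < level q j)"
    using \<open>n < level q k\<close> by (rule LeastI)
  then have "(LEAST j. n < level q j) \<noteq> 0" by (metis level_0 not_less0)
  then have Suc_j: "Suc j = (LEAST j. n < level q j)" by (simp add: j_def)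
  show ?thesis
  proof (rule that)
    show "n < level q (Suc j)" using * by (simp add: Suc_j)
    have "j < (LEAST j. n < level q j)" using Suc_j by simp
    then show "level q j \<le> n" using not_less_Least by (metis not_less)
    show "j < k" if "n < level q k" for k
      using that Least_le[of "\<lambda>j. n < level q j" k] Suc_j by simp
  qed
qed

text \<open>Group the indices \<open>j\<close> by the index \<open>i = I j\<close> of the level interval containing \<open>level q j div 4\<close>.
  All \<open>level q j\<close> in one group are comparable to \<open>level q (Suc i)\<close>, so the terms of a group grow
  geometrically in \<open>j\<close> while the lower bound on \<open>m\<close> caps the largest; this leaves a multiple of \<open>sqrt q ^ i\<close>.\<close>

lemma summable_sqrt_beta_level: "summable (\<lambda>j. sqrt (\<beta> (level q j)))"
proof -
  have "\<forall>\<^sub>F j in sequentially. m 0 * q ^ Suc j \<le> m (level q j) \<and> 1 \<le> level q j"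
    using filterlim_level by (intro eventually_conj level_ge) (auto simp: filterlim_at_top)
  then obtain j0 where j0: "\<And>j. j0 \<le> j \<Longrightarrow> m 0 * q ^ Suc j \<le> m (level q j) \<and> 1 \<le> level q j"
    by (auto simp: eventually_sequentially)
  define I where "I j = (SOME i. level q i \<le> level q j div 4 \<and> level q j div 4 < level q (Suc i)
    \<and> (\<forall>k. level q j div 4 < level q k \<longrightarrow> i < k))" for j
  have I: "level q (I j) \<le> level q j div 4" "level q j div 4 < level q (Suc (I j))"
    "\<And>k. level q j div 4 < level q k \<Longrightarrow> I j < k" for j
  proof -
    have "\<exists>i. level q i \<le> level q j div 4 \<and> level q j div 4 < level q (Suc i)
      \<and> (\<forall>k. level q j div 4 < level q k \<longrightarrow> i < k)"
      by (rule level_interval[of "level q j div 4"]) blast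
    from someI_ex[OF this, folded I_def]
    show "level q (I j) \<le> level q j div 4" "level q j div 4 < level q (Suc (I j))"
      "\<And>k. level q j div 4 < level q k \<Longrightarrow> I j < k" by auto
  qed
  define r where "r = sqrt q"
  have r: "0 < r" "r < 1" "q = r * r" using q by (auto simp: r_def)
  define B where "B = sqrt (4 * m 0 / c)"
  define N where "N i = sqrt (real (level q (Suc i)) + 1)" for i
  have N_pos: "0 < N i" for i by (simp add: N_def add_nonneg_pos)
  have B_nonneg: "0 \<le> B" using c_pos m_pos[of 0] by (simp add: B_def)
  have term_le: "sqrt (\<beta> (level q j)) \<le> r ^ I j / (r * N (I j)) * (1 / r) ^ j"
    and r_le: "(1 / r) ^ j \<le> B * N (I j)" and I_less: "I j < j" if j: "j0 \<le> j" for j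
  proof -
    let ?n = "level q j" and ?N = "level q (Suc (I j))"
    have n1: "1 \<le> ?n" and low: "m 0 * q ^ Suc j \<le> m ?n" using j0[OF j] by auto
    show Ij: "I j < j" using n1 by (intro I(3)) simp
    have Nn: "?N \<le> ?n" using Ij by (intro level_mono) simp
    have "m (?n div 4) \<le> m (level q (I j))" using I(1) by (rule m_antimono)
    also have "\<dots> \<le> m 0 * q ^ I j" by (rule level_le)
    finally have num: "m (?n div 4) \<le> m 0 * q ^ I j" .
    \<comment> \<open>The numerator is bounded because \<open>level q (I j)\<close> is at most
      \<open>level q j div 4\<close>; the denominator because \<open>Suc (I j)\<close> is at most j
      and the passage overshoots by at most one factor q.\<close>
    have "\<beta> ?n \<le> (m 0 * q ^ I j) / ((real ?N + 1) * (m 0 * q ^ Suc j))"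
      unfolding \<beta>_def using num Nn low q m_pos[of 0] m_pos[of "?n div 4"]
      by (intro frac_le mult_mono mult_pos_pos) auto
    also have "\<dots> = (m 0 * q ^ I j) / (m 0 * (q * (real ?N + 1) * q ^ j))"
      by (simp only: power_Suc mult_ac)
    also have "\<dots> = q ^ I j / (q * (real ?N + 1)) * (1 / q) ^ j"
      using m_pos[of 0] by (simp add: power_one_over)
    also have "\<dots> = (r ^ I j / (r * N (I j)) * (1 / r) ^ j)\<^sup>2"
      by (simp add: r(3) N_def power2_eq_square power_mult_distrib field_simps)
    finally show "sqrt (\<beta> ?n) \<le> r ^ I j / (r * N (I j)) * (1 / r) ^ j"
      using r N_pos[of "I j"] by (intro real_le_lsqrt) auto
    have "?n + 1 \<le> 4 * (?N + 1)" using I(2)[of j] by (simp add: div_less_iff_less_mult)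
    then have "real (?n + 1) \<le> real (4 * (?N + 1))" by (rule of_nat_mono)
    then have n4: "real ?n + 1 \<le> 4 * (real ?N + 1)" by simp
    have "c / (4 * (real ?N + 1)) \<le> c / (real ?n + 1)"
      using n4 c_pos by (intro frac_le) auto
    also have "\<dots> \<le> m ?n" by (rule lower)
    also have "\<dots> \<le> m 0 * q ^ j" by (rule level_le)
    finally have "(1 / q) ^ j \<le> (4 * m 0 / c) * (real ?N + 1)"
      using c_pos q by (simp add: field_simps)
    also have "\<dots> = (B * N (I j))\<^sup>2"
      using c_pos m_pos[of 0] by (simp add: B_def N_def power_mult_distrib)
    also have "(1 / q) ^ j = ((1 / r) ^ j)\<^sup>2"
      by (simp add: r(3) power2_eq_square power_mult_distrib field_simps)
    finally show "(1 / r) ^ j \<le> B * N (I j)"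
      by (rule power2_le_imp_le) (use B_nonneg N_pos[of "I j"] in auto)
  qed
  have "summable (\<lambda>j. sqrt (\<beta> (level q (j + j0))))"
  proof (rule summableI_nonneg_bounded)
    fix n
    let ?A = "\<lambda>i. {j \<in> {j0..<j0 + n}. I j = i}"
    have "(\<Sum>j<n. sqrt (\<beta> (level q (j + j0)))) = (\<Sum>j\<in>{j0..<j0 + n}. sqrt (\<beta> (level q j)))"
      by (rule sum.reindex_bij_witness[of _ "\<lambda>j. j - j0" "\<lambda>j. j + j0"]) auto
    also have "\<dots> = (\<Sum>i<j0 + n. \<Sum>j\<in>?A i. sqrt (\<beta> (level q j)))"
      using I_less by (intro sum.group[symmetric]) force+
    also have "\<dots> \<le> (\<Sum>i<j0 + n. r ^ i * (B / (r * (1 - r))))"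
    proof (rule sum_mono)
      fix i
      have "(\<Sum>j\<in>?A i. sqrt (\<beta> (level q j))) \<le> (\<Sum>j\<in>?A i. r ^ i / (r * N i) * (1 / r) ^ j)"
        using term_le by (intro sum_mono) auto
      also have "\<dots> = r ^ i / (r * N i) * (\<Sum>j\<in>?A i. (1 / r) ^ j)"
        by (simp add: sum_distrib_left)
      \<comment> \<open>The cap \<open>r_le\<close> on the largest power contributes
        \<open>N i\<close>, which cancels the \<open>N i\<close> in the denominator. What is left is
        a geometric series in i.\<close>
      also have "\<dots> \<le> r ^ i / (r * N i) * (B * N i / (1 - r))"
        using r N_pos[of i] B_nonneg r_le by (intro mult_left_mono sum_inverse_powers_le) auto
      also have "\<dots> = r ^ i * (B / (r * (1 - r)))"
        using N_pos[of i] by (simp add: field_simps)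
      finally show "(\<Sum>j\<in>?A i. sqrt (\<beta> (level q j))) \<le> r ^ i * (B / (r * (1 - r)))" .
    qed
    also have "\<dots> = (\<Sum>i<j0 + n. r ^ i) * (B / (r * (1 - r)))"
      by (simp only: sum_distrib_right)
    also have "\<dots> \<le> (\<Sum>i. r ^ i) * (B / (r * (1 - r)))"
      using r B_nonneg by (intro mult_right_mono sum_le_suminf summable_geometric) auto
    finally show "(\<Sum>j<n. sqrt (\<beta> (level q (j + j0)))) \<le> (\<Sum>i. r ^ i) * (B / (r * (1 - r)))" .
  qed (use beta_pos in \<open>auto simp: less_imp_le\<close>)
  then show ?thesis by (subst (asm) summable_iff_shift)
qed

text \<open>Monotonicity squeezes n between two consecutive passage times. The upper bound loses one
  factor q from the limit hypothesis and one from the width of the level; the lower bound loses a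
  third from the overshoot in \<open>level_ge\<close>.\<close>

lemma interpolate_levels:
  fixes x :: "nat \<Rightarrow> real"
  assumes x: "\<And>n. x (Suc n) \<le> x n"
    and lim: "(\<lambda>j. x (level q j) / m (level q j)) \<longlonglongrightarrow> 1"
  shows "\<forall>\<^sub>F n in sequentially. q ^ 3 \<le> x n / m n \<and> x n / m n \<le> 1 / q ^ 2"
proof -
  have x_antimono: "x j \<le> x i" if "i \<le> j" for i j using x that by (rule lift_Suc_antimono_le)
  have "\<forall>\<^sub>F j in sequentially. m 0 * q ^ Suc j \<le> m (level q j)
      \<and> q < x (level q j) / m (level q j) \<and> x (level q j) / m (level q j) < 1 / q"
    using q by (intro eventually_conj level_ge order_tendstoD[OF lim]) auto
  then obtain J where J: "\<And>j. J \<le> j \<Longrightarrow> m 0 * q ^ Suc j \<le> m (level q j)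
      \<and> q * m (level q j) \<le> x (level q j) \<and> x (level q j) \<le> 1 / q * m (level q j)"
    using m_pos unfolding eventually_sequentially pos_less_divide_eq[OF m_pos] pos_divide_less_eq[OF m_pos]
    by (blast intro: less_imp_le)
  have "q ^ 3 \<le> x n / m n \<and> x n / m n \<le> 1 / q ^ 2" if n: "level q J \<le> n" for n
  proof -
    obtain j where j: "level q j \<le> n" "n < level q (Suc j)" by (rule level_interval)
    have "J \<le> j"
    proof (rule ccontr)
      assume "\<not> J \<le> j"
      then have "level q (Suc j) \<le> level q J" by (intro level_mono) simp
      then show False using j n by simp
    qed
    note J1 = J[OF this] and J2 = J[OF le_SucI[OF this]]
    have "x n \<le> x (level q j)" using j by (intro x_antimono)
    also have "\<dots> \<le> 1 / q * m (level q j)" using J1 by simp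
    also have "\<dots> \<le> 1 / q * (m 0 * q ^ j)" using q by (intro mult_left_mono level_le) auto
    also have "\<dots> = 1 / q ^ 2 * (m 0 * q ^ Suc j)" using q by (simp add: field_simps power2_eq_square)
    also have "\<dots> \<le> 1 / q ^ 2 * m n"
      using q less_level[OF j(2)] by (intro mult_left_mono) auto
    finally have up: "x n \<le> 1 / q ^ 2 * m n" .
    have "q ^ 3 * m n \<le> q ^ 3 * (m 0 * q ^ j)"
      using q m_antimono[OF j(1)] level_le[of j] by (intro mult_left_mono) auto
    also have "\<dots> = q * (m 0 * q ^ Suc (Suc j))" by (simp add: power3_eq_cube)
    also have "\<dots> \<le> q * m (level q (Suc j))" using J2 q by (intro mult_left_mono) auto
    also have "\<dots> \<le> x (level q (Suc j))" using J2 by simp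
    also have "\<dots> \<le> x n" using j by (intro x_antimono) simp
    finally show ?thesis using up m_pos[of n] by (simp add: pos_le_divide_eq pos_divide_le_eq)
  qed
  then show ?thesis by (auto simp: eventually_sequentially)
qed

end

text \<open>Countably many q tending to 1 suffice, which lets the almost sure statements for the
  individual q be combined later.\<close>

lemma tendsto_of_levels:
  fixes x :: "nat \<Rightarrow> real"
  assumes to_0: "m \<longlonglongrightarrow> 0" and x: "\<And>n. x (Suc n) \<le> x n"
    and lim: "\<And>i. (\<lambda>j. x (level (1 - 1 / (real i + 2)) j) / m (level (1 - 1 / (real i + 2)) j)) \<longlonglongrightarrow> 1"
  shows "(\<lambda>n. x n / m n) \<longlonglongrightarrow> 1"
proof -
  let ?q = "\<lambda>i. 1 - 1 / (real i + 2)"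
  have ev: "\<forall>\<^sub>F n in sequentially. ?q i ^ 3 \<le> x n / m n \<and> x n / m n \<le> 1 / ?q i ^ 2" for i
    by (rule interpolate_levels) (use to_0 x lim in auto)
  show ?thesis
  proof (rule order_tendstoI)
    fix a :: real assume "a < 1"
    have "(\<lambda>i. ?q i ^ 3) \<longlonglongrightarrow> 1" by real_asymp
    then have "\<forall>\<^sub>F i in sequentially. a < ?q i ^ 3" using \<open>a < 1\<close> by (rule order_tendstoD)
    then obtain i where i: "a < ?q i ^ 3" by (auto simp: eventually_sequentially)
    show "\<forall>\<^sub>F n in sequentially. a < x n / m n"
      using ev[of i] by eventually_elim (use i in linarith)
  next
    fix a :: real assume "1 < a"
    have "(\<lambda>i. 1 / ?q i ^ 2) \<longlonglongrightarrow> 1" by real_asymp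
    then have "\<forall>\<^sub>F i in sequentially. 1 / ?q i ^ 2 < a" using \<open>1 < a\<close> by (rule order_tendstoD)
    then obtain i where i: "1 / ?q i ^ 2 < a" by (auto simp: eventually_sequentially)
    show "\<forall>\<^sub>F n in sequentially. x n / m n < a"
      using ev[of i] by eventually_elim (use i in linarith)
  qed
qed

end

text \<open>By monotone convergence the sum of the absolute values has finite mean, hence is finite
  almost surely, so its terms tend to 0.\<close>

lemma AE_tendsto_zero_of_summable:
  fixes Z :: "nat \<Rightarrow> 'a \<Rightarrow> real"
  assumes int: "\<And>n. integrable M (Z n)" and sum: "summable (\<lambda>n. \<integral>x. \<bar>Z n x\<bar> \<partial>M)"
  shows "AE x in M. (\<lambda>n. Z n x) \<longlonglongrightarrow> 0"
proof -
  have [measurable]: "Z n \<in> borel_measurable M" for n using int by blast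
  have "(\<integral>\<^sup>+x. (\<Sum>n. ennreal \<bar>Z n x\<bar>) \<partial>M) = (\<Sum>n. \<integral>\<^sup>+x. ennreal \<bar>Z n x\<bar> \<partial>M)"
    by (intro nn_integral_suminf) auto
  also have "\<dots> = (\<Sum>n. ennreal (\<integral>x. \<bar>Z n x\<bar> \<partial>M))"
    by (intro suminf_cong nn_integral_eq_integral) (use int in auto)
  also have "\<dots> = ennreal (\<Sum>n. \<integral>x. \<bar>Z n x\<bar> \<partial>M)"
    using sum by (intro suminf_ennreal2) auto
  finally have "(\<integral>\<^sup>+x. (\<Sum>n. ennreal \<bar>Z n x\<bar>) \<partial>M) \<noteq> \<infinity>" by simp
  then have "AE x in M. (\<Sum>n. ennreal \<bar>Z n x\<bar>) \<noteq> \<infinity>"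
    by (intro nn_integral_noteq_infinite) auto
  then show ?thesis
  proof eventually_elim
    case (elim x)
    then have "summable (\<lambda>n. \<bar>Z n x\<bar>)"
      by (intro summable_suminf_not_top) auto
    then have "(\<lambda>n. \<bar>Z n x\<bar>) \<longlonglongrightarrow> 0" by (rule summable_LIMSEQ_zero)
    then show ?case by (simp add: tendsto_rabs_zero_iff)
  qed
qed

text \<open>If \<open>m\<close> tends to 0, the relative mean deviations are summable along the
  passage times for every q. If the limit l is positive, the mean deviations tend to 0, so a
  subsequence converges almost surely; each path decreases to some limit, which must then be
  l.\<close>

lemma (in prob_space) AE_ratio_tendsto_1:
  fixes X :: "nat \<Rightarrow> 'a \<Rightarrow> real"
  assumes "convex_decay m c"
    and int: "\<And>n. integrable M (X n)"
    and mono: "AE x in M. \<forall>n. 0 \<le> X n x \<and> X (Suc n) x \<le> X n x"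
    and dev: "\<forall>\<^sub>F n in sequentially. (\<integral>x. \<bar>X n x - m n\<bar> \<partial>M) \<le> C * sqrt (convex_decay.\<beta> m n) * m n"
  shows "AE x in M. (\<lambda>n. X n x / m n) \<longlonglongrightarrow> 1"
proof -
  interpret convex_decay m c by fact
  obtain l where l: "m \<longlonglongrightarrow> l" "0 \<le> l" "\<And>n. l \<le> m n" using m_convergent by blast
  show ?thesis
  proof (cases "l = 0")
    case True
    let ?q = "\<lambda>i. 1 - 1 / (real i + 2)"
    have to_0: "m \<longlonglongrightarrow> 0" using l True by simp
    have "AE x in M. (\<lambda>j. X (level (?q i) j) x / m (level (?q i) j) - 1) \<longlonglongrightarrow> 0" for i
    proof (rule AE_tendsto_zero_of_summable)
      let ?n = "level (?q i)"
      have q: "0 < ?q i" "?q i < 1" by auto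
      show "integrable M (\<lambda>x. X (?n j) x / m (?n j) - 1)" for j
        using int by auto
      have "\<forall>\<^sub>F j in sequentially. (\<integral>x. \<bar>X (?n j) x - m (?n j)\<bar> \<partial>M) \<le> C * sqrt (\<beta> (?n j)) * m (?n j)"
        using dev filterlim_level[OF q to_0] by (rule eventually_compose_filterlim)
      then have "\<forall>\<^sub>F j in sequentially. norm (\<integral>x. \<bar>X (?n j) x / m (?n j) - 1\<bar> \<partial>M) \<le> C * sqrt (\<beta> (?n j))"
      proof eventually_elim
        case (elim j)
        have "(\<integral>x. \<bar>X (?n j) x / m (?n j) - 1\<bar> \<partial>M) = (\<integral>x. \<bar>X (?n j) x - m (?n j)\<bar> / m (?n j) \<partial>M)"
        proof (intro Bochner_Integration.integral_cong refl)
          fix x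
          have "X (?n j) x / m (?n j) - 1 = (X (?n j) x - m (?n j)) / m (?n j)"
            using m_pos[of "?n j"] by (simp add: field_simps)
          then show "\<bar>X (?n j) x / m (?n j) - 1\<bar> = \<bar>X (?n j) x - m (?n j)\<bar> / m (?n j)"
            using m_pos[of "?n j"] by simp
        qed
        also have "\<dots> \<le> C * sqrt (\<beta> (?n j))"
          using elim m_pos[of "?n j"] by (simp add: pos_divide_le_eq)
        finally show ?case by simp
      qed
      then show "summable (\<lambda>j. \<integral>x. \<bar>X (?n j) x / m (?n j) - 1\<bar> \<partial>M)"
        by (rule summable_comparison_test_ev)
          (intro summable_mult summable_sqrt_beta_level[OF q to_0])
    qed
    then have "AE x in M. \<forall>i. (\<lambda>j. X (level (?q i) j) x / m (level (?q i) j) - 1) \<longlonglongrightarrow> 0"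
      by (subst AE_all_countable) blast
    with mono show ?thesis
    proof eventually_elim
      case (elim x)
      show ?case
      proof (rule tendsto_of_levels[OF to_0])
        fix i
        have "(\<lambda>j. X (level (?q i) j) x / m (level (?q i) j) - 1 + 1) \<longlonglongrightarrow> 0 + 1"
          using elim by (intro tendsto_add tendsto_const) auto
        then show "(\<lambda>j. X (level (?q i) j) x / m (level (?q i) j)) \<longlonglongrightarrow> 1" by simp
      qed (use elim in auto)
    qed
  next
    case False
    then have l0: "0 < l" using l by simp
    have "(\<lambda>n. C * sqrt (\<beta> n) * m n) \<longlonglongrightarrow> C * sqrt 0 * l"
      by (intro tendsto_intros beta_tendsto l)
    then have lim: "(\<lambda>n. C * sqrt (\<beta> n) * m n) \<longlonglongrightarrow> 0" by simp
    have "(\<lambda>n. \<integral>x. norm (X n x - m n) \<partial>M) \<longlonglongrightarrow> 0"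
      by (rule tendsto_sandwich[OF _ _ tendsto_const lim]) (use dev in auto)
    then obtain s where s: "strict_mono s" "AE x in M. (\<lambda>n. X (s n) x - m (s n)) \<longlonglongrightarrow> 0"
      using tendsto_L1_AE_subseq[of M "\<lambda>n x. X n x - m n"] int by auto
    from mono s(2) show ?thesis
    proof eventually_elim
      case (elim x)
      have "decseq (\<lambda>n. X n x)" using elim by (auto intro: decseq_SucI)
      then obtain y where y: "(\<lambda>n. X n x) \<longlonglongrightarrow> y"
        using decseq_convergent[of "\<lambda>n. X n x" 0] elim by blast
      have "(\<lambda>n. X (s n) x - m (s n)) \<longlonglongrightarrow> y - l"
        using LIMSEQ_subseq_LIMSEQ[OF y s(1)] LIMSEQ_subseq_LIMSEQ[OF l(1) s(1)]
        by (intro tendsto_diff) (auto simp: o_def)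
      with elim have "y = l" using LIMSEQ_unique by fastforce
      then have "(\<lambda>n. X n x / m n) \<longlonglongrightarrow> l / l"
        using y l l0 by (intro tendsto_divide) auto
      then show ?case using l0 by simp
    qed
  qed
qed

section \<open>Self-similar structure and projections\<close>

text \<open>Each side is the integral of the positive part of the covering multiplicity minus one.\<close>

lemma overlap_mono:
  assumes "finite I" "\<And>i. i \<in> I \<Longrightarrow> A i \<in> fmeasurable M" "\<And>i. i \<in> I \<Longrightarrow> B i \<in> fmeasurable M"
    and "\<And>i. i \<in> I \<Longrightarrow> A i \<subseteq> B i"
  shows "(\<Sum>i\<in>I. measure M (A i)) - measure M (\<Union>i\<in>I. A i)
    \<le> (\<Sum>i\<in>I. measure M (B i)) - measure M (\<Union>i\<in>I. B i)"
  using assms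
proof (induction I rule: finite_induct)
  case (insert r I)
  let ?U = "\<lambda>A. \<Union>i\<in>I. A i"
  have fm: "?U A \<in> fmeasurable M" "?U B \<in> fmeasurable M"
    using insert by (auto intro!: fmeasurable.finite_UN)
  \<comment> \<open>A new set raises the defect by its overlap with the earlier union, and that
    overlap grows with the sets.\<close>
  have "measure M (A r \<inter> ?U A) \<le> measure M (B r \<inter> ?U B)"
    using insert.prems fm
    by (intro measure_mono_fmeasurable fmeasurable_Int_fmeasurable fmeasurableD sets.Int) (auto, blast)
  moreover have "measure M (A r \<union> ?U A) = measure M (A r) + measure M (?U A) - measure M (A r \<inter> ?U A)"
    and "measure M (B r \<union> ?U B) = measure M (B r) + measure M (?U B) - measure M (B r \<inter> ?U B)"
    using insert fm by (auto intro!: measure_Un3)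
  ultimately show ?case using insert by simp
qed simp

text \<open>Integrates \<open>1 \<ge> 2 a z - a\<^sup>2 z\<^sup>2\<close> for the covering multiplicity \<open>z\<close>; unlike the
  Cauchy-Schwarz form it stays linear when integrated over the angle.\<close>

lemma measure_UN_ge_second_moment:
  fixes a :: real
  assumes "finite I" "\<And>i. i \<in> I \<Longrightarrow> A i \<in> fmeasurable M"
  shows "2 * a * (\<Sum>i\<in>I. measure M (A i)) - a\<^sup>2 * (\<Sum>i\<in>I. \<Sum>j\<in>I. measure M (A i \<inter> A j))
    \<le> measure M (\<Union>i\<in>I. A i)"
proof -
  let ?Z = "\<lambda>x. \<Sum>i\<in>I. indicat_real (A i) x"
  let ?W = "\<lambda>x. \<Sum>i\<in>I. \<Sum>j\<in>I. indicat_real (A i \<inter> A j) x"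
  have int: "integrable M (indicat_real (A i))" if "i \<in> I" for i
    using assms(2)[OF that] by (simp add: integrable_indicator_iff fmeasurable_def)
  have int2: "integrable M (indicat_real (A i \<inter> A j))" if "i \<in> I" "j \<in> I" for i j
    using fmeasurable_Int_fmeasurable[OF assms(2)[OF that(1)] fmeasurableD[OF assms(2)[OF that(2)]]]
    by (simp add: integrable_indicator_iff fmeasurable_def)
  have U: "(\<Union>i\<in>I. A i) \<in> fmeasurable M"
    using assms by (auto intro!: fmeasurable.finite_UN)
  have meas: "(\<integral>x. indicat_real (B) x \<partial>M) = measure M B" if "B \<in> fmeasurable M" for B
    using fmeasurableD[OF that] by (simp add: sets.sets_into_space Int_absorb2)
  have "2 * a * (\<Sum>i\<in>I. measure M (A i)) - a\<^sup>2 * (\<Sum>i\<in>I. \<Sum>j\<in>I. measure M (A i \<inter> A j))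
      = (\<integral>x. 2 * a * ?Z x - a\<^sup>2 * ?W x \<partial>M)"
    using int int2 assms fmeasurable_Int_fmeasurable[OF assms(2) fmeasurableD[OF assms(2)]]
    by (simp add: Bochner_Integration.integral_diff Bochner_Integration.integral_sum meas)
  also have "\<dots> \<le> (\<integral>x. indicat_real (\<Union>i\<in>I. A i) x \<partial>M)"
  proof (intro integral_mono)
    show "integrable M (indicat_real (\<Union>i\<in>I. A i))"
      using U by (simp add: integrable_indicator_iff fmeasurable_def)
    fix x
    have W: "?W x = (?Z x)\<^sup>2"
      by (simp add: power2_eq_square sum_product indicator_inter_arith)
    show "2 * a * ?Z x - a\<^sup>2 * ?W x \<le> indicat_real (\<Union>i\<in>I. A i) x"
    proof (cases "x \<in> (\<Union>i\<in>I. A i)")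
      case True
      have "0 \<le> (1 - a * ?Z x)\<^sup>2" by simp
      then show ?thesis using True unfolding W
        by (simp add: power2_eq_square algebra_simps)
    next
      case False
      then have "?Z x = 0" by (intro sum.neutral) auto
      then show ?thesis using False unfolding W by simp
    qed
  qed (use int int2 in auto)
  also have "\<dots> = measure M (\<Union>i\<in>I. A i)" using U by (rule meas)
  finally show ?thesis .
qed

text \<open>The endpoints are the projected centre of the square plus and minus half the projected
  width. In this explicit form, measurability in the angle and the overlap of two projections become
  statements about inequalities.\<close>

lemma proj_grid_sq:
  assumes "0 < L"
  shows "proj_theta \<theta> ` grid_sq L n ij =
    {(- sin \<theta> * (2 * real (fst ij) + 1) + cos \<theta> * (2 * real (snd ij) + 1) - (\<bar>sin \<theta>\<bar> + \<bar>cos \<theta>\<bar>)) / (2 * real L ^ n) ..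
     (- sin \<theta> * (2 * real (fst ij) + 1) + cos \<theta> * (2 * real (snd ij) + 1) + (\<bar>sin \<theta>\<bar> + \<bar>cos \<theta>\<bar>)) / (2 * real L ^ n)}"
    (is "_ = {(?c - ?w) / ?N .. (?c + ?w) / ?N}")
proof (intro equalityI subsetI)
  let ?i = "real (fst ij)" and ?j = "real (snd ij)" and ?e = "real L ^ n"
  have e: "0 < ?e" using assms by simp
  fix t assume "t \<in> proj_theta \<theta> ` grid_sq L n ij"
  then obtain x y where t: "t = - sin \<theta> * x + cos \<theta> * y"
    and x: "?i / ?e \<le> x" "x \<le> (?i + 1) / ?e" and y: "?j / ?e \<le> y" "y \<le> (?j + 1) / ?e"
    by (auto simp: grid_sq_def proj_theta_def cbox_Pair_eq)
  \<comment> \<open>Coordinates of the point relative to the square, rescaled to [-1, 1].\<close>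
  define u v where "u = 2 * (x * ?e - ?i) - 1" and "v = 2 * (y * ?e - ?j) - 1"
  have "\<bar>u\<bar> \<le> 1" "\<bar>v\<bar> \<le> 1" using x y e by (auto simp: u_def v_def field_simps abs_le_iff)
  then have "\<bar>sin \<theta> * u\<bar> \<le> \<bar>sin \<theta>\<bar>" "\<bar>cos \<theta> * v\<bar> \<le> \<bar>cos \<theta>\<bar>"
    by (auto simp: abs_mult intro!: mult_left_le)
  moreover have "t * ?N = ?c + (- (sin \<theta> * u) + cos \<theta> * v)"
    using e by (simp add: t u_def v_def algebra_simps)
  ultimately have "?c - ?w \<le> t * ?N" "t * ?N \<le> ?c + ?w" by linarith+
  then show "t \<in> {(?c - ?w) / ?N .. (?c + ?w) / ?N}" using e by (simp add: field_simps)
next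
  let ?i = "real (fst ij)" and ?j = "real (snd ij)" and ?e = "real L ^ n"
  have e: "0 < ?e" using assms by simp
  fix t assume t: "t \<in> {(?c - ?w) / ?N .. (?c + ?w) / ?N}"
  have w: "0 < ?w" using sin_zero_abs_cos_one[of \<theta>] by (cases "sin \<theta> = 0") (auto intro: add_pos_nonneg)
  define s where "s = (t * ?N - ?c) / ?w"
  have s: "\<bar>s\<bar> \<le> 1" and ts: "t * ?N = ?c + s * ?w" using t w e by (auto simp: s_def abs_le_iff field_simps)
  \<comment> \<open>The witness moves from the centre in the direction whose signs make both
    coordinates contribute with the same sign; s = 1 and s = -1 give points where the projection is
    extremal.\<close>
  define x y where "x = (2 * ?i + 1 - s * sgn (sin \<theta>)) / ?N" and "y = (2 * ?j + 1 + s * sgn (cos \<theta>)) / ?N"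
  have sg: "\<bar>s * sgn z\<bar> \<le> 1" for z :: real using s by (auto simp: abs_mult sgn_if)
  have "?i / ?e \<le> x" "x \<le> (?i + 1) / ?e" "?j / ?e \<le> y" "y \<le> (?j + 1) / ?e"
  proof -
    have "(2 * ?i) / ?N \<le> x" "x \<le> (2 * ?i + 2) / ?N" "(2 * ?j) / ?N \<le> y" "y \<le> (2 * ?j + 2) / ?N"
      using sg[of "sin \<theta>"] sg[of "cos \<theta>"] e unfolding x_def y_def abs_le_iff
      by (intro divide_right_mono; linarith)+
    moreover have "(2 * ?i + 2) / ?N = (?i + 1) / ?e" "(2 * ?j + 2) / ?N = (?j + 1) / ?e"
      using e by (auto simp: field_simps)
    ultimately show "?i / ?e \<le> x" "x \<le> (?i + 1) / ?e" "?j / ?e \<le> y" "y \<le> (?j + 1) / ?e"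
      by simp_all
  qed
  then have "(x, y) \<in> grid_sq L n ij" by (auto simp: grid_sq_def cbox_Pair_eq)
  moreover have "t = proj_theta \<theta> (x, y)"
  proof -
    have "proj_theta \<theta> (x, y) * ?N = ?c + s * (sin \<theta> * sgn (sin \<theta>) + cos \<theta> * sgn (cos \<theta>))"
      using e by (simp add: proj_theta_def x_def y_def field_simps)
    then have "proj_theta \<theta> (x, y) * ?N = t * ?N"
      by (simp add: ts abs_sgn[symmetric])
    then show ?thesis using e assms by simp
  qed
  ultimately show "t \<in> proj_theta \<theta> ` grid_sq L n ij" by blast
qed

text \<open>An almost sure event on which all geometric estimates hold path by path. It constrains
  the choice at every index, also off the grid, so that it passes to subtrees at once.\<close>

definition good :: "nat \<Rightarrow> (nat \<times> nat \<times> nat \<Rightarrow> (nat \<times> nat) set) set" where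
  "good L = {\<omega>. \<forall>p. \<omega> p \<subseteq> {..<L} \<times> {..<L} \<and> card (\<omega> p) = L}"

lemma good_mem: "\<omega> \<in> good L \<Longrightarrow> (a, b) \<in> \<omega> p \<Longrightarrow> a < L \<and> b < L"
  unfolding good_def by blast

lemma finite_good:
  assumes "\<omega> \<in> good L"
  shows "finite (\<omega> p)"
proof -
  have "\<omega> p \<subseteq> {..<L} \<times> {..<L}" using assms unfolding good_def by blast
  then show ?thesis by (rule finite_subset) simp
qed

lemma good_card: "\<omega> \<in> good L \<Longrightarrow> card (\<omega> p) = L"
  unfolding good_def by blast

section \<open>Counting the selected squares\<close>

lemma sel_Suc_image:
  "sel L \<omega> (Suc n) = (\<lambda>((i, j), (a, b)). (L * i + a, L * j + b)) ` (SIGMA p:sel L \<omega> n. \<omega> (n, p))"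
  by (force simp: image_iff)

lemma mult_add_less_power:
  fixes i a L n :: nat
  assumes "i < L ^ n" "a < L"
  shows "L * i + a < L ^ Suc n"
proof -
  have "L * i + a < L * (i + 1)" using assms by simp
  also have "\<dots> \<le> L * L ^ n" using assms by (intro mult_left_mono) auto
  finally show ?thesis by simp
qed

lemma sel_subset: "\<omega> \<in> good L \<Longrightarrow> sel L \<omega> n \<subseteq> {..<L ^ n} \<times> {..<L ^ n}"
proof (induction n)
  case (Suc n)
  note * = good_mem[OF Suc.prems]
  show ?case using Suc.IH[OF Suc.prems] *
    by (auto dest!: subsetD simp del: power_Suc intro!: mult_add_less_power)
qed simp

lemma finite_sel: "\<omega> \<in> good L \<Longrightarrow> finite (sel L \<omega> n)"
  using sel_subset by (rule finite_subset) auto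

lemma card_sel: "\<omega> \<in> good L \<Longrightarrow> card (sel L \<omega> n) = L ^ n"
proof (induction n)
  case (Suc n)
  note * = good_mem[OF Suc.prems]
  have inj: "inj_on (\<lambda>((i, j), (a, b)). (L * i + a, L * j + b)) (SIGMA p:sel L \<omega> n. \<omega> (n, p))"
  proof (rule inj_onI, clarsimp)
    fix i j a b i' j' a' b'
    assume 1: "(a, b) \<in> \<omega> (n, i, j)" "(a', b') \<in> \<omega> (n, i', j')"
      and 2: "L * i + a = L * i' + a'" "L * j + b = L * j' + b'"
    have "(L * i + a) div L = i" "(L * i' + a') div L = i'" "(L * j + b) div L = j" "(L * j' + b') div L = j'"
      "(L * i + a) mod L = a" "(L * i' + a') mod L = a'" "(L * j + b) mod L = b" "(L * j' + b') mod L = b'"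
      using *[OF 1(1)] *[OF 1(2)] by auto
    with 2 show "i = i' \<and> j = j' \<and> a = a' \<and> b = b'" by metis
  qed
  show ?case unfolding sel_Suc_image card_image[OF inj]
    using Suc finite_good[OF Suc.prems] finite_sel[OF Suc.prems]
    by (subst card_SigmaI) (auto simp: good_card)
qed simp

text \<open>Each selected square has exactly L children, so the descendants multiply by at most L
  per generation; there are none when (a, b) itself is not selected. This is the upper regularity of
  the random set that the energy estimate uses.\<close>

lemma card_descendants_le:
  assumes \<omega>: "\<omega> \<in> good L" and "0 < L"
  shows "card {p \<in> sel L \<omega> (k + h). fst p div L ^ h = a \<and> snd p div L ^ h = b} \<le> L ^ h"
proof (induction h)
  case 0
  have "{p \<in> sel L \<omega> (k + 0). fst p div L ^ 0 = a \<and> snd p div L ^ 0 = b} \<subseteq> {(a, b)}" by auto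
  from card_mono[OF _ this] show ?case by simp
next
  case (Suc h)
  note * = good_mem[OF \<omega>]
  let ?D = "{p \<in> sel L \<omega> (k + h). fst p div L ^ h = a \<and> snd p div L ^ h = b}"
  have fin: "finite ?D" using finite_sel[OF \<omega>] by auto
  have "{p \<in> sel L \<omega> (k + Suc h). fst p div L ^ Suc h = a \<and> snd p div L ^ Suc h = b}
      \<subseteq> (\<lambda>((i, j), (a, b)). (L * i + a, L * j + b)) ` (SIGMA p:?D. \<omega> (k + h, p))"
  proof
    fix p assume p: "p \<in> {p \<in> sel L \<omega> (k + Suc h). fst p div L ^ Suc h = a \<and> snd p div L ^ Suc h = b}"
    then obtain i j a' b' where p': "p = (L * i + a', L * j + b')" "(i, j) \<in> sel L \<omega> (k + h)" "(a', b') \<in> \<omega> (k + h, i, j)"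
      by auto
    have "(L * i + a') div L ^ Suc h = i div L ^ h" "(L * j + b') div L ^ Suc h = j div L ^ h"
      using *[OF p'(3)] by (auto simp: div_mult2_eq)
    with p p' show "p \<in> (\<lambda>((i, j), (a, b)). (L * i + a, L * j + b)) ` (SIGMA p:?D. \<omega> (k + h, p))"
      by (force simp: image_iff)
  qed
  then have "card {p \<in> sel L \<omega> (k + Suc h). fst p div L ^ Suc h = a \<and> snd p div L ^ Suc h = b}
      \<le> card (SIGMA p:?D. \<omega> (k + h, p))"
    using fin finite_good[OF \<omega>] by (intro surj_card_le) auto
  also have "\<dots> = card ?D * L"
    using fin finite_good[OF \<omega>] by (subst card_SigmaI) (auto simp: good_card[OF \<omega>])
  also have "\<dots> \<le> L ^ h * L" using Suc by (intro mult_right_mono) auto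
  finally show ?case by (simp add: mult.commute)
qed

text \<open>Outside the grid the values of \<open>child\<close> are junk; they only serve to make the maps
  \<open>child L R\<close> injective with pairwise disjoint ranges, so that the subtrees \<open>subtree L R \<omega>\<close>
  are independent copies of \<open>\<omega>\<close>.\<close>

fun child :: "nat \<Rightarrow> nat \<times> nat \<Rightarrow> nat \<times> nat \<times> nat \<Rightarrow> nat \<times> nat \<times> nat" where
  "child L (a, b) (n, i, j) =
    (if i < L ^ n \<and> j < L ^ n then (Suc n, a * L ^ n + i, b * L ^ n + j)
     else (Suc n, L ^ Suc n + prod_encode (prod_encode (a, b), prod_encode (i, j)), 0))"

definition subtree :: "nat \<Rightarrow> nat \<times> nat \<Rightarrow> (nat \<times> nat \<times> nat \<Rightarrow> (nat \<times> nat) set) \<Rightarrow> (nat \<times> nat \<times> nat \<Rightarrow> (nat \<times> nat) set)" where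
  "subtree L R \<omega> = (\<lambda>p. \<omega> (child L R p))"

lemma subtree_good: "\<omega> \<in> good L \<Longrightarrow> subtree L R \<omega> \<in> good L"
  unfolding good_def subtree_def by blast

lemma child_ne_0: "child L R p \<noteq> (0, q)"
  by (cases R; cases p) auto

lemma mult_add_less_mult:
  fixes a i N L :: nat
  assumes "a < L" "i < N"
  shows "a * N + i < L * N"
proof -
  have "a * N + i < (a + 1) * N" using assms by simp
  also have "\<dots> \<le> L * N" using assms by (intro mult_right_mono) auto
  finally show ?thesis .
qed

lemma child_inj:
  assumes "R \<in> {..<L} \<times> {..<L}" "R' \<in> {..<L} \<times> {..<L}" and eq: "child L R p = child L R' p'"
  shows "R = R' \<and> p = p'"
proof -
  obtain a b a' b' n i j n' i' j' where R: "R = (a, b)" "R' = (a', b')" "p = (n, i, j)" "p' = (n', i', j')"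
    by (metis surj_pair)
  have ab: "a < L" "b < L" "a' < L" "b' < L" using assms R by auto
  have n: "n' = n" using eq by (auto simp: R split: if_splits)
  let ?N = "L ^ n"
  \<comment> \<open>Genuine children have first grid coordinate below \<open>L ^ Suc n\<close>,
    where the junk values begin; this rules out the mixed cases.\<close>
  have lt: "c * ?N + k < L ^ Suc n" if "c < L" "k < ?N" for c k
    using mult_add_less_mult[OF that] by simp
  show ?thesis
  proof (cases "i < ?N \<and> j < ?N"; cases "i' < ?N \<and> j' < ?N")
    assume 1: "i < ?N \<and> j < ?N" and 2: "i' < ?N \<and> j' < ?N"
    then have "a * ?N + i = a' * ?N + i'" "b * ?N + j = b' * ?N + j'"
      using eq by (auto simp: R n)
    moreover have "(c * ?N + k) div ?N = c \<and> (c * ?N + k) mod ?N = k" if "k < ?N" for c k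
      using that by (metis add.right_neutral div_less div_mult_self3 mod_less mod_mult_self3 not_less_zero)
    ultimately show ?thesis using R n 1 2 by metis
  next
    assume 1: "i < ?N \<and> j < ?N" and 2: "\<not> (i' < ?N \<and> j' < ?N)"
    then show ?thesis using eq lt[OF ab(1), of i] by (auto simp: R n)
  next
    assume 1: "\<not> (i < ?N \<and> j < ?N)" and 2: "i' < ?N \<and> j' < ?N"
    then show ?thesis using eq lt[OF ab(3), of i'] by (auto simp: R n)
  next
    assume 1: "\<not> (i < ?N \<and> j < ?N)" and 2: "\<not> (i' < ?N \<and> j' < ?N)"
    then have "prod_encode (prod_encode (a, b), prod_encode (i, j)) = prod_encode (prod_encode (a', b'), prod_encode (i', j'))"
      using eq by (auto simp: R n simp del: power_Suc split: if_splits)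
    then show ?thesis by (simp add: prod_encode_eq R n)
  qed
qed

text \<open>\<open>sel\<close> refines at the finest generation, whereas self-similarity needs the
  tree unfolded at the root. The two agree because refining a cell commutes with translating it into
  the first-generation square R, and on grid cells \<open>child\<close> is exactly this
  translation.\<close>

lemma sel_Suc_subtree:
  assumes \<omega>: "\<omega> \<in> good L"
  shows "sel L \<omega> (Suc n) = (\<Union>R\<in>\<omega> (0, 0, 0). (\<lambda>p. (fst R * L ^ n + fst p, snd R * L ^ n + snd p)) ` sel L (subtree L R \<omega>) n)"
proof (induction n)
  case 0
  show ?case by force
next
  case (Suc n)
  let ?f = "\<lambda>n R p. (fst R * L ^ n + fst p, snd R * L ^ n + snd p :: nat)"
  show ?case
  proof (intro equalityI subsetI)
    fix q assume "q \<in> sel L \<omega> (Suc (Suc n))"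
    then obtain i j a b where q: "q = (L * i + a, L * j + b)" "(i, j) \<in> sel L \<omega> (Suc n)" "(a, b) \<in> \<omega> (Suc n, i, j)"
      unfolding sel.simps(2)[of L \<omega> "Suc n"] by blast
    then obtain R p where R: "R \<in> \<omega> (0, 0, 0)" and p: "p \<in> sel L (subtree L R \<omega>) n" "(i, j) = ?f n R p"
      using Suc.IH by (auto simp del: sel.simps)
    have "fst p < L ^ n" "snd p < L ^ n" using sel_subset[OF subtree_good[OF \<omega>]] p(1) by fastforce+
    then have "subtree L R \<omega> (n, p) = \<omega> (Suc n, i, j)"
      using p(2) by (cases R; cases p) (auto simp: subtree_def)
    then have "(fst p, snd p) \<in> sel L (subtree L R \<omega>) n" "(a, b) \<in> subtree L R \<omega> (n, fst p, snd p)"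
      using p(1) q(3) by auto
    then have "(L * fst p + a, L * snd p + b) \<in> sel L (subtree L R \<omega>) (Suc n)"
      unfolding sel.simps(2) by blast
    moreover have "q = ?f (Suc n) R (L * fst p + a, L * snd p + b)"
      using p(2) by (simp add: q algebra_simps)
    ultimately show "q \<in> (\<Union>R\<in>\<omega> (0, 0, 0). ?f (Suc n) R ` sel L (subtree L R \<omega>) (Suc n))"
      using R by blast
  next
    fix q assume "q \<in> (\<Union>R\<in>\<omega> (0, 0, 0). ?f (Suc n) R ` sel L (subtree L R \<omega>) (Suc n))"
    then obtain R r where R: "R \<in> \<omega> (0, 0, 0)" and r: "q = ?f (Suc n) R r" "r \<in> sel L (subtree L R \<omega>) (Suc n)"
      by blast
    from r(2) obtain i j a b where "r = (L * i + a, L * j + b)"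
      and ij: "(i, j) \<in> sel L (subtree L R \<omega>) n" and ab: "(a, b) \<in> subtree L R \<omega> (n, i, j)"
      unfolding sel.simps(2) by blast
    with r(1) have q: "q = ?f (Suc n) R (L * i + a, L * j + b)" by simp
    have "i < L ^ n" "j < L ^ n" using sel_subset[OF subtree_good[OF \<omega>]] ij by fastforce+
    then have "subtree L R \<omega> (n, i, j) = \<omega> (Suc n, fst R * L ^ n + i, snd R * L ^ n + j)"
      by (cases R) (auto simp: subtree_def)
    then have ab': "(a, b) \<in> \<omega> (Suc n, fst R * L ^ n + i, snd R * L ^ n + j)" using ab by simp
    have "?f n R (i, j) \<in> sel L \<omega> (Suc n)" unfolding Suc.IH using R ij by blast
    then have ij': "(fst R * L ^ n + i, snd R * L ^ n + j) \<in> sel L \<omega> (Suc n)" by simp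
    have "q = (L * (fst R * L ^ n + i) + a, L * (snd R * L ^ n + j) + b)"
      by (simp add: q algebra_simps)
    with ij' ab' show "q \<in> sel L \<omega> (Suc (Suc n))" by (subst sel.simps(2)) blast
  qed
qed

section \<open>Shadows and their decomposition over the first generation\<close>

definition shadow :: "real \<Rightarrow> (real \<times> real) set \<Rightarrow> real" where
  "shadow \<theta> A = measure lborel (proj_theta \<theta> ` A)"

lemma proj_rand_set:
  "proj_theta \<theta> ` rand_set L \<omega> n = (\<Union>p\<in>sel L \<omega> n. proj_theta \<theta> ` grid_sq L n p)"
  by (auto simp: rand_set_def)

lemma grid_sq_Suc_subset:
  assumes "0 < L" "a < L" "b < L"
  shows "grid_sq L (Suc n) (L * i + a, L * j + b) \<subseteq> grid_sq L n (i, j)"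
proof -
  have *: "real i / real L ^ n \<le> real (L * i + a) / real L ^ Suc n \<and>
      (real (L * i + a) + 1) / real L ^ Suc n \<le> (real i + 1) / real L ^ n" if "a < L" for i a
  proof -
    have "(real a + 1) * real L ^ n \<le> real L * real L ^ n"
      using that by (intro mult_right_mono) auto
    then show ?thesis using assms by (simp add: field_simps)
  qed
  show ?thesis unfolding grid_sq_def
    using *[OF assms(2), of i] *[OF assms(3), of j] by (simp add: cbox_Pair_eq Sigma_mono)
qed

lemma rand_set_Suc_subset:
  assumes "\<omega> \<in> good L" "0 < L"
  shows "rand_set L \<omega> (Suc n) \<subseteq> rand_set L \<omega> n"
  unfolding rand_set_def
proof (rule UN_least)
  fix q assume "q \<in> sel L \<omega> (Suc n)"
  then obtain i j a b where q: "q = (L * i + a, L * j + b)" "(i, j) \<in> sel L \<omega> n" "(a, b) \<in> \<omega> (n, i, j)"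
    by auto
  then show "grid_sq L (Suc n) q \<subseteq> (\<Union>p\<in>sel L \<omega> n. grid_sq L n p)"
    using grid_sq_Suc_subset[of L a b n i j] good_mem[OF assms(1) q(3)] assms(2) by blast
qed

lemma proj_grid_sq_child:
  assumes "0 < L"
  shows "proj_theta \<theta> ` grid_sq L (Suc n) (fst R * L ^ n + fst p, snd R * L ^ n + snd p)
    = (\<lambda>t. (1 / real L) * t + proj_theta \<theta> (real (fst R), real (snd R)) / real L) ` (proj_theta \<theta> ` grid_sq L n p)"
  unfolding proj_grid_sq[OF assms] using assms
  by (subst image_affinity_atLeastAtMost) (auto simp: proj_theta_def field_simps)

lemma proj_rand_set_Suc:
  assumes "\<omega> \<in> good L" "0 < L"
  shows "proj_theta \<theta> ` rand_set L \<omega> (Suc n) = (\<Union>R\<in>\<omega> (0, 0, 0).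
    (\<lambda>t. (1 / real L) * t + proj_theta \<theta> (real (fst R), real (snd R)) / real L) ` (proj_theta \<theta> ` rand_set L (subtree L R \<omega>) n))"
proof -
  have "proj_theta \<theta> ` rand_set L \<omega> (Suc n) = (\<Union>R\<in>\<omega> (0, 0, 0). \<Union>p\<in>sel L (subtree L R \<omega>) n.
      proj_theta \<theta> ` grid_sq L (Suc n) (fst R * L ^ n + fst p, snd R * L ^ n + snd p))"
    unfolding proj_rand_set sel_Suc_subtree[OF assms(1)] by blast
  then show ?thesis unfolding proj_rand_set image_UN proj_grid_sq_child[OF assms(2)] .
qed

lemma compact_proj_rand_set: "finite (sel L \<omega> n) \<Longrightarrow> compact (proj_theta \<theta> ` rand_set L \<omega> n)"
  unfolding rand_set_def grid_sq_def proj_theta_def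
  by (intro compact_continuous_image compact_UN continuous_intros) auto

lemma compact_fmeasurable: "compact A \<Longrightarrow> A \<in> fmeasurable lborel" for A :: "real set"
  by (intro fmeasurableI emeasure_compact_finite) (simp_all add: borel_compact)

lemma measure_affine_image:
  fixes A :: "real set"
  assumes "compact A" "0 < c"
  shows "measure lborel ((\<lambda>t. c * t + d) ` A) = c * measure lborel A"
proof -
  have "(\<lambda>t. c * t + d) ` A \<in> sets borel"
    using assms(1) by (intro borel_compact compact_continuous_image continuous_intros)
  moreover have "A \<in> sets borel" using assms(1) by (rule borel_compact)
  ultimately show ?thesis
    using measure_lebesgue_affine[of c d A] assms(2) by (simp add: measure_completion)
qed

text \<open>\<open>B n R\<close> is the projected piece inside R. The first claim is subadditivity
  of length. In the second, both sides are total length minus length of the union, and the pieces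
  shrink with n, so \<open>overlap_mono\<close> applies at each angle.\<close>

lemma shadow_Suc:
  assumes \<omega>: "\<omega> \<in> good L" and L: "0 < L"
  shows "shadow \<theta> (rand_set L \<omega> (Suc n)) \<le> (\<Sum>R\<in>\<omega> (0, 0, 0). shadow \<theta> (rand_set L (subtree L R \<omega>) n)) / real L" (is ?le)
    and "(\<Sum>R\<in>\<omega> (0, 0, 0). shadow \<theta> (rand_set L (subtree L R \<omega>) (Suc n))) / real L - shadow \<theta> (rand_set L \<omega> (Suc (Suc n)))
      \<le> (\<Sum>R\<in>\<omega> (0, 0, 0). shadow \<theta> (rand_set L (subtree L R \<omega>) n)) / real L - shadow \<theta> (rand_set L \<omega> (Suc n))" (is ?mono)
proof -
  define B where "B n R = (\<lambda>t. (1 / real L) * t + proj_theta \<theta> (real (fst R), real (snd R)) / real L) ` (proj_theta \<theta> ` rand_set L (subtree L R \<omega>) n)" for n R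
  have cpt: "compact (proj_theta \<theta> ` rand_set L (subtree L R \<omega>) n)" for R n
    using finite_sel[OF subtree_good[OF \<omega>]] by (rule compact_proj_rand_set)
  have B: "B n R \<in> fmeasurable lborel" for n R
    unfolding B_def by (intro compact_fmeasurable compact_continuous_image[OF _ cpt] continuous_intros)
  have measure_B: "measure lborel (B n R) = shadow \<theta> (rand_set L (subtree L R \<omega>) n) / real L" for n R
    unfolding B_def using measure_affine_image[OF cpt, of "1 / real L"] L by (simp add: shadow_def)
  have Suc: "shadow \<theta> (rand_set L \<omega> (Suc n)) = measure lborel (\<Union>R\<in>\<omega> (0, 0, 0). B n R)" for n
    unfolding shadow_def proj_rand_set_Suc[OF \<omega> L] B_def ..
  have fin: "finite (\<omega> (0, 0, 0))" using \<omega> by (rule finite_good)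
  have sub: "B (Suc n) R \<subseteq> B n R" for n R
    unfolding B_def using rand_set_Suc_subset[OF subtree_good[OF \<omega>] L] by blast
  show ?le unfolding Suc sum_divide_distrib measure_B[symmetric]
    using fin B by (intro measure_UNION_le) (auto simp: fmeasurable_def)
  show ?mono unfolding Suc sum_divide_distrib measure_B[symmetric]
    using fin B sub by (intro overlap_mono)
qed

lemma measurable_mem_component [measurable]:
  "Measurable.pred (grid_space X) (\<lambda>\<omega>. q \<in> \<omega> p)"
proof -
  have "(\<lambda>\<omega>. \<omega> p) \<in> grid_space X \<rightarrow>\<^sub>M measure_pmf X"
    unfolding grid_space_def by (rule measurable_component_singleton) simp
  moreover have "Measurable.pred (measure_pmf X) (\<lambda>A. q \<in> A)" by simp
  ultimately show ?thesis by (rule measurable_compose)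
qed

lemma measurable_mem_sel [measurable]: "Measurable.pred (grid_space X) (\<lambda>\<omega>. p \<in> sel L \<omega> n)"
proof (induction n arbitrary: p)
  case (Suc n)
  have [measurable]: "Measurable.pred (grid_space X) (\<lambda>\<omega>. (i, j) \<in> sel L \<omega> n)" for i j by (rule Suc)
  have "(p \<in> sel L \<omega> (Suc n)) = (\<exists>i j a b. p = (L * i + a, L * j + b) \<and> (i, j) \<in> sel L \<omega> n \<and> (a, b) \<in> \<omega> (n, i, j))" for \<omega>
    by auto
  then show ?case by simp
qed simp

text \<open>A point t lies in the projection exactly when it satisfies two inequalities for one of
  countably many selected cells. So membership is measurable jointly in the path, the angle and t,
  and integrating t out leaves the shadow.\<close>

lemma measurable_shadow:
  assumes "0 < L"
  shows "(\<lambda>x. shadow (snd x) (rand_set L (fst x) n)) \<in> borel_measurable (grid_space X \<Otimes>\<^sub>M lborel)"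
proof -
  let ?c = "\<lambda>\<theta> p. - sin \<theta> * (2 * real (fst p) + 1) + cos \<theta> * (2 * real (snd p) + 1)" and ?w = "\<lambda>\<theta>. \<bar>sin \<theta>\<bar> + \<bar>cos \<theta>\<bar>"
    and ?N = "2 * real L ^ n"
  define P where "P x t = (\<exists>p. p \<in> sel L (fst x) n \<and> (?c (snd x) p - ?w (snd x)) / ?N \<le> t \<and> t \<le> (?c (snd x) p + ?w (snd x)) / ?N)"
    for x :: "(nat \<times> nat \<times> nat \<Rightarrow> (nat \<times> nat) set) \<times> real" and t
  have mem: "t \<in> proj_theta (snd x) ` rand_set L (fst x) n \<longleftrightarrow> P x t" for x t
    unfolding proj_rand_set proj_grid_sq[OF assms] P_def by (simp only: UN_iff atLeastAtMost_iff Bex_def)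
  let ?M = "(grid_space X \<Otimes>\<^sub>M lborel) \<Otimes>\<^sub>M (lborel :: real measure)"
  have P [measurable]: "Measurable.pred ?M (\<lambda>(x, t). P x t)"
  proof -
    have le: "Measurable.pred ?M (\<lambda>y. f y \<le> g y)"
      if "f \<in> borel_measurable ?M" "g \<in> borel_measurable ?M" for f g :: "_ \<Rightarrow> real"
      unfolding pred_def using that by (rule borel_measurable_le)
    have angle: "(\<lambda>y. f (snd (fst y))) \<in> borel_measurable ?M"
      if "continuous_on UNIV f" for f :: "real \<Rightarrow> real"
    proof -
      have "f \<in> borel_measurable lborel"
        using borel_measurable_continuous_onI[OF that] by simp
      then show ?thesis
        by (rule measurable_compose[OF measurable_compose[OF measurable_fst measurable_snd]])
    qed
    have mem: "Measurable.pred ?M (\<lambda>y. p \<in> sel L (fst (fst y)) n)" for p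
      by (rule measurable_compose[OF measurable_compose[OF measurable_fst measurable_fst] measurable_mem_sel])
    have lo: "(\<lambda>y. (?c (snd (fst y)) p - ?w (snd (fst y))) / ?N) \<in> borel_measurable ?M"
      and hi: "(\<lambda>y. (?c (snd (fst y)) p + ?w (snd (fst y))) / ?N) \<in> borel_measurable ?M" for p
      by (rule angle, use assms in \<open>intro continuous_intros, simp\<close>)+
    have "snd \<in> borel_measurable ?M" by simp
    note * = le[OF lo this] le[OF this hi]
    have "Measurable.pred ?M (\<lambda>y. p \<in> sel L (fst (fst y)) n \<and>
        (?c (snd (fst y)) p - ?w (snd (fst y))) / ?N \<le> snd y \<and> snd y \<le> (?c (snd (fst y)) p + ?w (snd (fst y))) / ?N)" for p
      by (intro pred_intros_logic mem *)
    then show ?thesis unfolding P_def case_prod_beta by (rule pred_intros_countable)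
  qed
  have "shadow (snd x) (rand_set L (fst x) n) = enn2real (\<integral>\<^sup>+t. (if P x t then 1 else 0) \<partial>lborel)" for x
  proof -
    have "proj_theta (snd x) ` rand_set L (fst x) n \<in> sets borel"
      unfolding proj_rand_set proj_grid_sq[OF assms] by (intro sets.countable_UN') auto
    then have "(\<integral>\<^sup>+t. indicator (proj_theta (snd x) ` rand_set L (fst x) n) t \<partial>lborel)
        = emeasure lborel (proj_theta (snd x) ` rand_set L (fst x) n)" by simp
    moreover have "indicator (proj_theta (snd x) ` rand_set L (fst x) n) t = (if P x t then 1 else 0 :: ennreal)" for t
      by (simp add: indicator_def mem)
    ultimately show ?thesis by (simp add: shadow_def measure_def)
  qed
  moreover have "(\<lambda>x. enn2real (\<integral>\<^sup>+t. (if P x t then 1 else 0) \<partial>lborel)) \<in> borel_measurable (grid_space X \<Otimes>\<^sub>M lborel)"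
    by measurable
  ultimately show ?thesis by simp
qed

section \<open>Favard length as an integral of shadows\<close>

lemma Fav_eq: "Fav A = (\<integral>\<theta>. indicator {0<..<pi} \<theta> * shadow \<theta> A \<partial>lborel)"
proof -
  have "einterval 0 (ereal pi) = {0<..<pi}" by (simp add: zero_ereal_def)
  then show ?thesis
    by (simp add: Fav_def shadow_def interval_lebesgue_integral_def set_lebesgue_integral_def)
qed

lemma space_grid_space [simp]: "space (grid_space X) = UNIV"
  by (simp add: grid_space_def space_PiM)

lemma measurable_shadow_angle:
  assumes "0 < L"
  shows "(\<lambda>\<theta>. shadow \<theta> (rand_set L \<omega> n)) \<in> borel_measurable lborel"
proof -
  \<comment> \<open>The claim concerns a single \<omega>, so any distribution may be the argument of
    \<open>grid_space\<close>: its space is always \<open>UNIV\<close>.\<close>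
  have "(\<lambda>\<theta>. (\<omega>, \<theta>)) \<in> lborel \<rightarrow>\<^sub>M grid_space undefined \<Otimes>\<^sub>M lborel" by simp
  from measurable_compose[OF this measurable_shadow[OF assms]] show ?thesis by simp
qed

lemma measurable_Fav:
  assumes "0 < L"
  shows "(\<lambda>\<omega>. Fav (rand_set L \<omega> n)) \<in> borel_measurable (grid_space X)"
  unfolding Fav_eq
proof (rule sigma_finite_measure.borel_measurable_lebesgue_integral)
  have "(\<lambda>x. indicator {0<..<pi} (snd x) * shadow (snd x) (rand_set L (fst x) n)) \<in> borel_measurable (grid_space X \<Otimes>\<^sub>M lborel)"
    using measurable_shadow[OF assms] by (intro borel_measurable_times) auto
  then show "(\<lambda>(\<omega>, \<theta>). indicator {0<..<pi} \<theta> * shadow \<theta> (rand_set L \<omega> n)) \<in> borel_measurable (grid_space X \<Otimes>\<^sub>M lborel)"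
    by (simp add: case_prod_beta)
qed (rule lborel.sigma_finite_measure_axioms)

lemma shadow_nonneg: "0 \<le> shadow \<theta> A"
  by (simp add: shadow_def)

lemma proj_rand_set_subset:
  assumes "\<omega> \<in> good L" "0 < L"
  shows "proj_theta \<theta> ` rand_set L \<omega> n \<subseteq> {-2..2}"
proof (induction n)
  case 0
  have "\<bar>- sin \<theta> * x + cos \<theta> * y\<bar> \<le> 2" if "0 \<le> x" "x \<le> 1" "0 \<le> y" "y \<le> 1" for x y :: real
  proof -
    have "\<bar>sin \<theta> * x\<bar> \<le> 1 * 1" "\<bar>cos \<theta> * y\<bar> \<le> 1 * 1"
      unfolding abs_mult using that by (intro mult_mono; simp)+
    then show ?thesis by linarith
  qed
  then show ?case
    by (fastforce simp: rand_set_def grid_sq_def cbox_Pair_eq proj_theta_def abs_le_iff)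
next
  case (Suc n)
  then show ?case using rand_set_Suc_subset[OF assms, of n] by blast
qed

lemma shadow_le:
  assumes "\<omega> \<in> good L" "0 < L"
  shows "shadow \<theta> (rand_set L \<omega> n) \<le> 4"
proof -
  have "shadow \<theta> (rand_set L \<omega> n) \<le> measure lborel {-2..2::real}"
    unfolding shadow_def
    by (intro measure_mono_fmeasurable proj_rand_set_subset[OF assms] compact_fmeasurable
        fmeasurableD[OF compact_fmeasurable] compact_proj_rand_set finite_sel[OF assms(1)]) auto
  then show ?thesis by simp
qed

lemma shadow_antimono:
  assumes "\<omega> \<in> good L" "0 < L"
  shows "shadow \<theta> (rand_set L \<omega> (Suc n)) \<le> shadow \<theta> (rand_set L \<omega> n)"
  unfolding shadow_def
  by (intro measure_mono_fmeasurable image_mono rand_set_Suc_subset[OF assms] compact_fmeasurable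
      fmeasurableD[OF compact_fmeasurable] compact_proj_rand_set finite_sel[OF assms(1)])

lemma integrable_shadow:
  assumes "\<omega> \<in> good L" "0 < L"
  shows "integrable lborel (\<lambda>\<theta>. indicator {0<..<pi} \<theta> * shadow \<theta> (rand_set L \<omega> n))"
proof (rule Bochner_Integration.integrable_bound[where f = "\<lambda>\<theta>. 4 * indicator {0<..<pi} \<theta> :: real"])
  show "AE \<theta> in lborel. norm (indicator {0<..<pi} \<theta> * shadow \<theta> (rand_set L \<omega> n)) \<le> norm (4 * indicator {0<..<pi} \<theta> :: real)"
    using shadow_le[OF assms] shadow_nonneg by (auto simp: indicator_def)
qed (use measurable_shadow_angle[OF assms(2)] in \<open>auto intro!: borel_measurable_times\<close>)

lemma Fav_nonneg: "0 \<le> Fav A"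
  unfolding Fav_eq by (intro integral_nonneg_AE) (simp add: shadow_nonneg)

lemma Fav_le:
  assumes "\<omega> \<in> good L" "0 < L"
  shows "Fav (rand_set L \<omega> n) \<le> 4 * pi"
proof -
  have "Fav (rand_set L \<omega> n) \<le> (\<integral>\<theta>. 4 * indicator {0<..<pi} \<theta> \<partial>lborel)"
    unfolding Fav_eq
  proof (rule integral_mono[OF integrable_shadow[OF assms]])
    show "integrable lborel (\<lambda>\<theta>. 4 * indicator {0<..<pi} \<theta> :: real)"
      by (rule integrable_mult_right, rule integrable_real_indicator) auto
    show "indicator {0<..<pi} \<theta> * shadow \<theta> (rand_set L \<omega> n) \<le> 4 * indicator {0<..<pi} \<theta>" for \<theta>
      using shadow_le[OF assms] by (auto simp: indicator_def)
  qed
  then show ?thesis by simp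
qed

lemma Fav_antimono:
  assumes "\<omega> \<in> good L" "0 < L"
  shows "Fav (rand_set L \<omega> (Suc n)) \<le> Fav (rand_set L \<omega> n)"
  unfolding Fav_eq
  by (intro integral_mono integrable_shadow assms mult_left_mono shadow_antimono) auto

lemma Fav_Suc:
  assumes \<omega>: "\<omega> \<in> good L" and L: "0 < L"
  shows "Fav (rand_set L \<omega> (Suc n)) \<le> (\<Sum>R\<in>\<omega> (0, 0, 0). Fav (rand_set L (subtree L R \<omega>) n)) / real L" (is ?le)
    and "(\<Sum>R\<in>\<omega> (0, 0, 0). Fav (rand_set L (subtree L R \<omega>) (Suc n))) / real L - Fav (rand_set L \<omega> (Suc (Suc n)))
      \<le> (\<Sum>R\<in>\<omega> (0, 0, 0). Fav (rand_set L (subtree L R \<omega>) n)) / real L - Fav (rand_set L \<omega> (Suc n))" (is ?mono)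
proof -
  let ?F = "\<lambda>n \<omega> \<theta>. indicator {0<..<pi} \<theta> * shadow \<theta> (rand_set L \<omega> n)"
  note int = integrable_shadow[OF \<omega> L] integrable_shadow[OF subtree_good[OF \<omega>] L]
  have sum: "(\<Sum>R\<in>\<omega> (0, 0, 0). Fav (rand_set L (subtree L R \<omega>) n)) / real L
      = (\<integral>\<theta>. (\<Sum>R\<in>\<omega> (0, 0, 0). ?F n (subtree L R \<omega>) \<theta>) / real L \<partial>lborel)" for n
    unfolding Fav_eq using int by (subst Bochner_Integration.integral_divide_zero)
      (simp add: Bochner_Integration.integral_sum)
  have eq: "(\<Sum>R\<in>\<omega> (0, 0, 0). ?F n (subtree L R \<omega>) \<theta>) / real L
      = indicator {0<..<pi} \<theta> * ((\<Sum>R\<in>\<omega> (0, 0, 0). shadow \<theta> (rand_set L (subtree L R \<omega>) n)) / real L)" for n \<theta>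
    by (simp add: sum_distrib_left)
  have int': "integrable lborel (\<lambda>\<theta>. (\<Sum>R\<in>\<omega> (0, 0, 0). ?F n (subtree L R \<omega>) \<theta>) / real L)" for n
    using int by (intro Bochner_Integration.integrable_divide Bochner_Integration.integrable_sum) auto
  show ?le unfolding sum unfolding Fav_eq
    by (rule integral_mono[OF int(1) int']) (unfold eq, intro mult_left_mono shadow_Suc(1)[OF \<omega> L], simp)
  have diff: "(\<Sum>R\<in>\<omega> (0, 0, 0). Fav (rand_set L (subtree L R \<omega>) n)) / real L - Fav (rand_set L \<omega> (Suc n))
      = (\<integral>\<theta>. (\<Sum>R\<in>\<omega> (0, 0, 0). ?F n (subtree L R \<omega>) \<theta>) / real L - ?F (Suc n) \<omega> \<theta> \<partial>lborel)" for n
    unfolding sum unfolding Fav_eq by (rule Bochner_Integration.integral_diff[symmetric, OF int' int(1)])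
  show ?mono unfolding diff
    by (rule integral_mono[OF Bochner_Integration.integrable_diff[OF int' int(1)] Bochner_Integration.integrable_diff[OF int' int(1)]])
      (unfold eq right_diff_distrib[symmetric], intro mult_left_mono shadow_Suc(2)[OF \<omega> L], simp)
qed

section \<open>The energy bound\<close>

text \<open>The lower bound on Favard length integrates only over this window of length 1 about pi /
  2. It lies inside (0, pi) and keeps \<open>sin\<close> away from 0.\<close>

lemma sin_ge_half:
  fixes \<theta> :: real
  assumes "\<theta> \<in> {pi / 2 - 1 / 2 .. pi / 2 + 1 / 2}"
  shows "1 / 2 \<le> sin \<theta>"
proof -
  have "\<bar>pi / 2 - \<theta>\<bar> \<le> 1 / 2" using assms unfolding atLeastAtMost_iff by linarith
  then have "cos (pi / 3) \<le> cos \<bar>pi / 2 - \<theta>\<bar>"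
    using pi_gt3 by (intro cos_monotone_0_pi_le) auto
  then show ?thesis by (simp add: cos_60 cos_sin_eq[of "pi / 2 - \<theta>"])
qed

lemma abs_sin_ge_half:
  fixes x :: real
  assumes "\<bar>x\<bar> \<le> 1"
  shows "\<bar>x\<bar> / 2 \<le> \<bar>sin x\<bar>"
proof (cases "x = 0")
  case False
  have "\<exists>z. 0 < z \<and> z < \<bar>x\<bar> \<and> sin \<bar>x\<bar> - sin 0 = (\<bar>x\<bar> - 0) * cos z"
    using False by (intro MVT2) auto
  then obtain z where z: "0 < z" "z < \<bar>x\<bar>" "sin \<bar>x\<bar> = \<bar>x\<bar> * cos z" by auto
  have "cos (pi / 3) \<le> cos z"
    using z assms pi_gt3 by (intro cos_monotone_0_pi_le) auto
  then have "\<bar>x\<bar> * (1 / 2) \<le> sin \<bar>x\<bar>"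
    unfolding z(3) by (intro mult_left_mono) (auto simp: cos_60)
  moreover have "\<bar>sin x\<bar> = \<bar>sin \<bar>x\<bar>\<bar>" by (auto simp: abs_if)
  ultimately show ?thesis by simp
qed simp

text \<open>Here x and y are differences of cell indices. One collision angle in the window forces
  \<open>\<bar>x\<bar> \<le> \<bar>y\<bar> + 4\<close>, so the maximum is comparable to
  \<open>\<bar>y\<bar>\<close>. If y = 0, the length 1 of the window is small enough. Otherwise two
  collision angles differ by at most \<open>8 / \<bar>y\<bar>\<close>, the set has length at most
  \<open>16 / \<bar>y\<bar>\<close>, and one plus the maximum is at most
  \<open>6 * \<bar>y\<bar>\<close>; the product of 16 and 6 is 96.\<close>

lemma measure_collision_angles_le:
  fixes x y :: real
  assumes y: "y = 0 \<or> 1 \<le> \<bar>y\<bar>"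
  shows "measure lborel {\<theta> \<in> {pi / 2 - 1 / 2 .. pi / 2 + 1 / 2}. \<bar>- x * sin \<theta> + y * cos \<theta>\<bar> \<le> 2}
    \<le> 96 / (1 + max \<bar>x\<bar> \<bar>y\<bar>)"
proof -
  let ?J = "{pi / 2 - 1 / 2 .. pi / 2 + 1 / 2 :: real}"
  let ?E = "{\<theta> \<in> ?J. \<bar>- x * sin \<theta> + y * cos \<theta>\<bar> \<le> 2}"
  have "closed (?J \<inter> {\<theta>. \<bar>- x * sin \<theta> + y * cos \<theta>\<bar> \<le> 2})"
    by (intro closed_Int closed_Collect_le continuous_intros)
  moreover have E_eq: "?E = ?J \<inter> {\<theta>. \<bar>- x * sin \<theta> + y * cos \<theta>\<bar> \<le> 2}" by auto
  ultimately have E: "?E \<in> sets lborel" by simp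
  show ?thesis
  proof (cases "?E = {}")
    case False
    then obtain \<theta> where \<theta>: "\<theta> \<in> ?J" "\<bar>- x * sin \<theta> + y * cos \<theta>\<bar> \<le> 2" by auto
    have x_le: "\<bar>x\<bar> \<le> \<bar>y\<bar> + 4"
    proof -
      have c: "\<bar>cos \<theta>\<bar> \<le> 1 / 2"
      proof -
        have "\<bar>cos \<theta>\<bar> = \<bar>sin (pi / 2 - \<theta>)\<bar>" by (simp add: sin_diff)
        also have "\<dots> \<le> \<bar>pi / 2 - \<theta>\<bar>" by (rule abs_sin_x_le_abs_x)
        finally show ?thesis using \<theta>(1) by auto
      qed
      have "\<bar>x\<bar> * (1 / 2) \<le> \<bar>x * sin \<theta>\<bar>"
        unfolding abs_mult using sin_ge_half[OF \<theta>(1)] by (intro mult_left_mono) auto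
      moreover have "\<bar>y * cos \<theta>\<bar> \<le> \<bar>y\<bar> * (1 / 2)"
        unfolding abs_mult using c by (intro mult_left_mono) auto
      ultimately show ?thesis using \<theta>(2) by linarith
    qed
    show ?thesis
    proof (cases "y = 0")
      case True
      have "measure lborel ?E \<le> measure lborel ?J"
        using E by (intro measure_mono_fmeasurable compact_fmeasurable) auto
      also have "\<dots> = 1" by simp
      also have "\<dots> \<le> 96 / (1 + max \<bar>x\<bar> \<bar>y\<bar>)" using x_le True by (simp add: field_simps)
      finally show ?thesis .
    next
      case False
      then have y1: "1 \<le> \<bar>y\<bar>" using y by simp
      have "?E \<subseteq> {\<theta> - 8 / \<bar>y\<bar> .. \<theta> + 8 / \<bar>y\<bar>}"
      proof
        fix \<phi> assume \<phi>: "\<phi> \<in> ?E"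
        let ?f = "\<lambda>\<theta>. - x * sin \<theta> + y * cos \<theta>"
        \<comment> \<open>This combination eliminates x and leaves only the difference of the two
          angles.\<close>
        have "y * sin (\<phi> - \<theta>) = sin \<phi> * ?f \<theta> - sin \<theta> * ?f \<phi>"
          by (simp add: sin_diff algebra_simps)
        also have "\<bar>\<dots>\<bar> \<le> \<bar>sin \<phi> * ?f \<theta>\<bar> + \<bar>sin \<theta> * ?f \<phi>\<bar>" by (rule abs_triangle_ineq4)
        also have "\<dots> \<le> 1 * 2 + 1 * 2"
          unfolding abs_mult[of "sin _"] using \<theta> \<phi> by (intro add_mono mult_mono) auto
        finally have 1: "\<bar>y\<bar> * \<bar>sin (\<phi> - \<theta>)\<bar> \<le> 4" by (simp add: abs_mult)
        have "\<bar>y\<bar> * (\<bar>\<phi> - \<theta>\<bar> / 2) \<le> \<bar>y\<bar> * \<bar>sin (\<phi> - \<theta>)\<bar>"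
          using \<theta> \<phi> by (intro mult_left_mono abs_sin_ge_half) auto
        with 1 have "\<bar>\<phi> - \<theta>\<bar> * \<bar>y\<bar> \<le> 8" by (simp add: mult.commute)
        then have "\<bar>\<phi> - \<theta>\<bar> \<le> 8 / \<bar>y\<bar>" using y1 by (subst pos_le_divide_eq) auto
        then show "\<phi> \<in> {\<theta> - 8 / \<bar>y\<bar> .. \<theta> + 8 / \<bar>y\<bar>}" by (auto simp: abs_le_iff)
      qed
      then have "measure lborel ?E \<le> measure lborel {\<theta> - 8 / \<bar>y\<bar> .. \<theta> + 8 / \<bar>y\<bar>}"
        using E by (intro measure_mono_fmeasurable compact_fmeasurable) auto
      also have "\<dots> = 16 / \<bar>y\<bar>" by simp
      also have "\<dots> \<le> 96 / (1 + max \<bar>x\<bar> \<bar>y\<bar>)" using x_le y1 by (simp add: field_simps max_def)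
      finally show ?thesis .
    qed
  next
    case True
    then have "measure lborel ?E = 0" by (simp only: measure_empty)
    also have "0 \<le> 96 / (1 + max \<bar>x\<bar> \<bar>y\<bar>)" by simp
    finally show ?thesis .
  qed
qed

text \<open>Cells this close to p have their ancestors k generations up in the three by three block
  around the ancestor of p, and each ancestor has at most \<open>L ^ k\<close> descendants.
  Truncated subtraction only cuts the block at the border of the grid.\<close>

lemma card_close_le:
  assumes \<omega>: "\<omega> \<in> good L" and L: "0 < L" and "k \<le> n"
  shows "card {q \<in> sel L \<omega> n. fst q < fst p + L ^ k \<and> fst p < fst q + L ^ k \<and> snd q < snd p + L ^ k \<and> snd p < snd q + L ^ k}
    \<le> 9 * L ^ k"
proof -
  let ?A = "\<lambda>i::nat. {i div L ^ k - 1 .. i div L ^ k + 1}"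
  let ?D = "\<lambda>r. {q \<in> sel L \<omega> (n - k + k). fst q div L ^ k = fst r \<and> snd q div L ^ k = snd r}"
  have A: "i div L ^ k \<in> ?A j" if "i < j + L ^ k" "j < i + L ^ k" for i j
  proof -
    have "i div L ^ k \<le> (j + L ^ k) div L ^ k" "j div L ^ k \<le> (i + L ^ k) div L ^ k"
      using that by (auto intro!: div_le_mono)
    then show ?thesis using L by auto
  qed
  have fin: "finite (?D r)" for r using finite_sel[OF \<omega>] by auto
  have "card {q \<in> sel L \<omega> n. fst q < fst p + L ^ k \<and> fst p < fst q + L ^ k \<and> snd q < snd p + L ^ k \<and> snd p < snd q + L ^ k}
      \<le> card (\<Union>r\<in>?A (fst p) \<times> ?A (snd p). ?D r)"
    using fin A \<open>k \<le> n\<close> by (intro card_mono) auto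
  also have "\<dots> \<le> (\<Sum>r\<in>?A (fst p) \<times> ?A (snd p). card (?D r))"
    by (intro card_UN_le) auto
  also have "\<dots> \<le> (\<Sum>r\<in>?A (fst p) \<times> ?A (snd p). L ^ k)"
    using card_descendants_le[OF \<omega> L] by (intro sum_mono)
  also have "\<dots> \<le> (3 * 3) * L ^ k"
  proof -
    have "card (?A i) \<le> 3" for i by simp
    then have "card (?A (fst p) \<times> ?A (snd p)) \<le> 3 * 3"
      unfolding card_cartesian_product by (intro mult_mono) auto
    then show ?thesis unfolding sum_constant of_nat_id by (intro mult_right_mono) auto
  qed
  finally show ?thesis by simp
qed

text \<open>Take the least k with \<open>r < L ^ k\<close>. If k is positive, minimality gives
  \<open>L ^ (k - 1) \<le> r\<close>, so this one summand, with its extra factor L, already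
  dominates; the others are nonnegative. The layers turn the energy into a count of pairs at each
  scale.\<close>

lemma inverse_le_layer_sum:
  fixes L :: nat and r :: real
  assumes "2 \<le> L" "0 \<le> r" "r < real L ^ n"
  shows "1 / (1 + r) \<le> (\<Sum>k\<le>n. (real L / real L ^ k) * (if r < real L ^ k then 1 else 0))"
proof -
  define k where "k = (LEAST k. r < real L ^ k)"
  have k: "r < real L ^ k" unfolding k_def using assms(3) by (rule LeastI)
  have kn: "k \<le> n" unfolding k_def using assms(3) by (rule Least_le)
  have "1 / (1 + r) \<le> real L / real L ^ k"
  proof (cases k)
    case 0
    have "1 / (1 + r) \<le> 1" using assms by (simp add: field_simps)
    also have "\<dots> \<le> real L / real L ^ k" using 0 assms by simp
    finally show ?thesis .
  next
    case (Suc j)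
    then have "\<not> r < real L ^ j" using not_less_Least[of j "\<lambda>k. r < real L ^ k"] by (simp add: k_def)
    then have "1 / (1 + r) \<le> 1 / real L ^ j" using assms by (intro divide_left_mono) (auto intro!: add_nonneg_pos)
    then show ?thesis using Suc assms by simp
  qed
  also have "\<dots> = (real L / real L ^ k) * (if r < real L ^ k then 1 else 0)" using k by simp
  also have "\<dots> \<le> (\<Sum>k\<le>n. (real L / real L ^ k) * (if r < real L ^ k then 1 else 0))"
    using kn by (intro member_le_sum) auto
  finally show ?thesis .
qed

definition cell_dist :: "nat \<times> nat \<Rightarrow> nat \<times> nat \<Rightarrow> real" where
  "cell_dist p q = max \<bar>real (fst p) - real (fst q)\<bar> \<bar>real (snd p) - real (snd q)\<bar>"

text \<open>A discrete energy with exponent 1, the critical exponent for a set of dimension 1: each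
  of the n + 1 scales contributes at most \<open>9 * L\<close> per cell. This is the source of the
  factor n + 1 in the lower bound on Favard length.\<close>

lemma energy_le:
  assumes \<omega>: "\<omega> \<in> good L" and L: "2 \<le> L"
  shows "(\<Sum>p\<in>sel L \<omega> n. \<Sum>q\<in>sel L \<omega> n. 1 / (1 + cell_dist p q)) \<le> real L ^ n * (9 * real L * (real n + 1))"
proof -
  have L0: "0 < L" using L by simp
  have inner: "(\<Sum>q\<in>sel L \<omega> n. 1 / (1 + cell_dist p q)) \<le> 9 * real L * (real n + 1)"
    if p: "p \<in> sel L \<omega> n" for p
  proof -
    have "cell_dist p q < real L ^ n" if "q \<in> sel L \<omega> n" for q
    proof -
      have "fst p < L ^ n" "snd p < L ^ n" "fst q < L ^ n" "snd q < L ^ n"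
        using sel_subset[OF \<omega>] p that by fastforce+
      then have "real (fst p) < real L ^ n" "real (snd p) < real L ^ n" "real (fst q) < real L ^ n" "real (snd q) < real L ^ n"
        by (metis of_nat_less_iff of_nat_power)+
      then show ?thesis
        unfolding cell_dist_def max_less_iff_conj abs_less_iff
        using of_nat_0_le_iff[of "fst p", where ?'a = real] of_nat_0_le_iff[of "snd p", where ?'a = real]
          of_nat_0_le_iff[of "fst q", where ?'a = real] of_nat_0_le_iff[of "snd q", where ?'a = real]
        by linarith
    qed
    then have "(\<Sum>q\<in>sel L \<omega> n. 1 / (1 + cell_dist p q))
        \<le> (\<Sum>q\<in>sel L \<omega> n. \<Sum>k\<le>n. (real L / real L ^ k) * (if cell_dist p q < real L ^ k then 1 else 0))"
      by (intro sum_mono inverse_le_layer_sum L) (auto simp: cell_dist_def)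
    also have "\<dots> = (\<Sum>k\<le>n. (real L / real L ^ k) * (\<Sum>q\<in>sel L \<omega> n. if cell_dist p q < real L ^ k then 1 else 0))"
      by (subst sum.swap) (simp add: sum_distrib_left)
    also have "\<dots> \<le> (\<Sum>k\<le>n. (real L / real L ^ k) * (9 * real L ^ k))"
    proof (intro sum_mono mult_left_mono)
      fix k assume "k \<in> {..n}"
      have "(\<Sum>q\<in>sel L \<omega> n. if cell_dist p q < real L ^ k then 1 else 0 :: real)
          = real (card {q \<in> sel L \<omega> n. cell_dist p q < real L ^ k})"
        using finite_sel[OF \<omega>] by (simp add: sum.If_cases Int_def)
      also have "{q \<in> sel L \<omega> n. cell_dist p q < real L ^ k} = {q \<in> sel L \<omega> n. fst q < fst p + L ^ k \<and> fst p < fst q + L ^ k \<and> snd q < snd p + L ^ k \<and> snd p < snd q + L ^ k}"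
      proof -
        have "\<bar>real i - real j\<bar> < real L ^ k \<longleftrightarrow> j < i + L ^ k \<and> i < j + L ^ k" for i j
          by (simp add: abs_less_iff flip: of_nat_power) linarith
        then show ?thesis by (auto simp: cell_dist_def)
      qed
      also have "real (card \<dots>) \<le> real (9 * L ^ k)"
        using card_close_le[OF \<omega> L0, of k n p] \<open>k \<in> {..n}\<close> by (intro of_nat_mono) auto
      finally show "(\<Sum>q\<in>sel L \<omega> n. if cell_dist p q < real L ^ k then 1 else 0 :: real) \<le> 9 * real L ^ k" by simp
    qed auto
    also have "\<dots> = 9 * real L * (real n + 1)" using L by simp
    finally show ?thesis .
  qed
  have "(\<Sum>p\<in>sel L \<omega> n. \<Sum>q\<in>sel L \<omega> n. 1 / (1 + cell_dist p q)) \<le> (\<Sum>p\<in>sel L \<omega> n. 9 * real L * (real n + 1))"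
    using inner by (rule sum_mono)
  then show ?thesis by (simp add: card_sel[OF \<omega>])
qed

text \<open>Each projected square has length between \<open>1 / L ^ n\<close> and
  \<open>2 / L ^ n\<close>. So the total length is at least 1, and two projections meet only if the
  index difference satisfies the collision condition, whose bound 2 comes from
  \<open>\<bar>sin \<theta>\<bar> + \<bar>cos \<theta>\<bar> \<le> 2\<close>.\<close>

lemma shadow_ge:
  fixes a :: real
  assumes \<omega>: "\<omega> \<in> good L" and L: "2 \<le> L" and a: "0 \<le> a"
  shows "2 * a - a\<^sup>2 * (2 / real L ^ n) * (\<Sum>p\<in>sel L \<omega> n. \<Sum>q\<in>sel L \<omega> n.
      indicator {\<theta>. \<bar>- (real (fst p) - real (fst q)) * sin \<theta> + (real (snd p) - real (snd q)) * cos \<theta>\<bar> \<le> 2} \<theta>)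
    \<le> shadow \<theta> (rand_set L \<omega> n)"
proof -
  have L0: "0 < L" using L by simp
  let ?S = "sel L \<omega> n" and ?e = "real L ^ n"
  let ?A = "\<lambda>p. proj_theta \<theta> ` grid_sq L n p"
  let ?I = "\<lambda>p q. indicator {\<theta>. \<bar>- (real (fst p) - real (fst q)) * sin \<theta> + (real (snd p) - real (snd q)) * cos \<theta>\<bar> \<le> 2} \<theta> :: real"
  let ?w = "\<bar>sin \<theta>\<bar> + \<bar>cos \<theta>\<bar>"
  have e: "0 < ?e" using L by simp
  have w1: "1 \<le> ?w"
  proof -
    have "1\<^sup>2 = \<bar>sin \<theta>\<bar>\<^sup>2 + \<bar>cos \<theta>\<bar>\<^sup>2" by simp
    also have "\<dots> \<le> ?w\<^sup>2" by (simp add: power2_sum)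
    finally show ?thesis by (rule power2_le_imp_le) simp
  qed
  have w2: "?w \<le> 2" using abs_sin_le_one[of \<theta>] abs_cos_le_one[of \<theta>] by linarith
  have A: "?A p \<in> fmeasurable lborel" for p
    unfolding proj_grid_sq[OF L0] by (intro compact_fmeasurable) simp
  have m: "measure lborel (?A p) = ?w / ?e" for p
  proof -
    have "(c + ?w) / (2 * ?e) - (c - ?w) / (2 * ?e) = ?w / ?e" for c
      using e by (simp add: field_simps)
    moreover have "(c - ?w) / (2 * ?e) \<le> (c + ?w) / (2 * ?e)" for c
      using e by (intro divide_right_mono) auto
    ultimately show ?thesis unfolding proj_grid_sq[OF L0] by simp
  qed
  have m2: "measure lborel (?A p \<inter> ?A q) \<le> 2 / ?e * ?I p q" for p q
  proof (cases "?A p \<inter> ?A q = {}")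
    case False
    let ?c = "\<lambda>p. - sin \<theta> * (2 * real (fst p) + 1) + cos \<theta> * (2 * real (snd p) + 1)"
    obtain t where "t \<in> ?A p" "t \<in> ?A q" using False by blast
    then have "?c p - ?w \<le> t * (2 * ?e)" "t * (2 * ?e) \<le> ?c p + ?w" "?c q - ?w \<le> t * (2 * ?e)" "t * (2 * ?e) \<le> ?c q + ?w"
      unfolding proj_grid_sq[OF L0] using e by (auto simp: pos_divide_le_eq pos_le_divide_eq)
    moreover have "\<bar>x - y\<bar> \<le> 2 * w" if "x - w \<le> s" "s \<le> x + w" "y - w \<le> s" "s \<le> y + w" for x y w s :: real
      using that by linarith
    ultimately have "\<bar>?c p - ?c q\<bar> \<le> 2 * ?w" by blast
    moreover have "?c p - ?c q = 2 * (- (real (fst p) - real (fst q)) * sin \<theta> + (real (snd p) - real (snd q)) * cos \<theta>)"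
      by (simp add: algebra_simps)
    ultimately have "2 * \<bar>- (real (fst p) - real (fst q)) * sin \<theta> + (real (snd p) - real (snd q)) * cos \<theta>\<bar> \<le> 2 * ?w"
      by (simp only: abs_mult abs_numeral)
    moreover have "x \<le> 2" if "2 * x \<le> 2 * w" "w \<le> 2" for x w :: real
      using that by linarith
    ultimately have "\<bar>- (real (fst p) - real (fst q)) * sin \<theta> + (real (snd p) - real (snd q)) * cos \<theta>\<bar> \<le> 2"
      using w2 by blast
    then have "?I p q = 1" by simp
    moreover have "measure lborel (?A p \<inter> ?A q) \<le> measure lborel (?A p)"
      using A by (intro measure_mono_fmeasurable) (auto intro!: sets.Int dest: fmeasurableD)
    moreover have "?w / ?e \<le> 2 / ?e" using w2 e by (intro divide_right_mono) auto
    ultimately show ?thesis using m[of p] by simp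
  qed (use e in simp)
  have "2 * a = 2 * a * (\<Sum>p\<in>?S. 1 / ?e)"
    using e L by (simp add: card_sel[OF \<omega>])
  also have "\<dots> \<le> 2 * a * (\<Sum>p\<in>?S. measure lborel (?A p))"
    unfolding m using w1 e a by (intro mult_left_mono sum_mono divide_right_mono) auto
  finally have 1: "2 * a \<le> 2 * a * (\<Sum>p\<in>?S. measure lborel (?A p))" .
  have "a\<^sup>2 * (\<Sum>p\<in>?S. \<Sum>q\<in>?S. measure lborel (?A p \<inter> ?A q)) \<le> a\<^sup>2 * (\<Sum>p\<in>?S. \<Sum>q\<in>?S. 2 / ?e * ?I p q)"
    by (intro mult_left_mono sum_mono m2) simp
  also have "\<dots> = a\<^sup>2 * (2 / ?e) * (\<Sum>p\<in>?S. \<Sum>q\<in>?S. ?I p q)"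
    by (simp only: sum_distrib_left[symmetric] mult.assoc)
  finally have 2: "a\<^sup>2 * (\<Sum>p\<in>?S. \<Sum>q\<in>?S. measure lborel (?A p \<inter> ?A q)) \<le> a\<^sup>2 * (2 / ?e) * (\<Sum>p\<in>?S. \<Sum>q\<in>?S. ?I p q)" .
  show ?thesis
    unfolding shadow_def proj_rand_set
    by (rule order_trans[OF diff_mono[OF 1 2] measure_UN_ge_second_moment[OF finite_sel[OF \<omega>] A]])
qed

lemma Fav_ge:
  assumes \<omega>: "\<omega> \<in> good L" and L: "2 \<le> L"
  shows "1 / (1728 * real L) / (real n + 1) \<le> Fav (rand_set L \<omega> n)"
proof -
  let ?S = "sel L \<omega> n" and ?e = "real L ^ n" and ?J = "{pi / 2 - 1 / 2 .. pi / 2 + 1 / 2 :: real}"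
  let ?E = "\<lambda>p q. {\<theta>. \<bar>- (real (fst p) - real (fst q)) * sin \<theta> + (real (snd p) - real (snd q)) * cos \<theta>\<bar> \<le> 2}"
  have e: "0 < ?e" and L0: "0 < L" using L by auto
  \<comment> \<open>1728 is the product of 2 from the length of a projection, 96 from the collision
    angles and 9 from the energy. The choice \<open>a = 1 / D\<close> maximises
    \<open>2 * a - a\<^sup>2 * D\<close>, with value \<open>1 / D\<close>.\<close>
  define D where "D = 1728 * real L * (real n + 1)"
  define a where "a = 1 / D"
  have D: "0 < D" using L by (simp add: D_def)
  have a: "0 < a" using D by (simp add: a_def)
  have JE: "?J \<inter> ?E p q \<in> fmeasurable lborel" for p q
  proof (rule fmeasurableI2)
    show "?J \<in> fmeasurable lborel" by (intro compact_fmeasurable) simp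
    have "closed (?J \<inter> ?E p q)"
      by (intro closed_Int closed_Collect_le continuous_intros)
    then show "?J \<inter> ?E p q \<in> sets lborel" by simp
  qed auto
  have int_JE: "integrable lborel (indicat_real (?J \<inter> ?E p q))" for p q
    using JE by (intro integrable_real_indicator) (auto simp: fmeasurable_def)
  have int_J: "integrable lborel (indicat_real ?J)"
    by (intro integrable_real_indicator) auto
  have coll: "measure lborel (?J \<inter> ?E p q) \<le> 96 * (1 / (1 + cell_dist p q))" for p q
  proof -
    have "?J \<inter> ?E p q = {\<theta> \<in> ?J. \<bar>- (real (fst p) - real (fst q)) * sin \<theta> + (real (snd p) - real (snd q)) * cos \<theta>\<bar> \<le> 2}"
      by auto
    moreover have "real (snd p) - real (snd q) = 0 \<or> 1 \<le> \<bar>real (snd p) - real (snd q)\<bar>"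
      by (cases "snd p" "snd q" rule: linorder_cases) auto
    ultimately show ?thesis
      using measure_collision_angles_le[of "real (snd p) - real (snd q)" "real (fst p) - real (fst q)"]
      by (simp add: cell_dist_def)
  qed
  have "1 / D = 2 * a - a\<^sup>2 * D"
    using D by (simp add: a_def power2_eq_square field_simps)
  also have "\<dots> = 2 * a - a\<^sup>2 * (2 / ?e) * (96 * (?e * (9 * real L * (real n + 1))))"
    using e by (simp add: D_def)
  also have "\<dots> \<le> 2 * a - a\<^sup>2 * (2 / ?e) * (96 * (\<Sum>p\<in>?S. \<Sum>q\<in>?S. 1 / (1 + cell_dist p q)))"
    using energy_le[OF \<omega> L, of n] e by (intro diff_left_mono mult_left_mono) auto
  also have "\<dots> \<le> 2 * a - a\<^sup>2 * (2 / ?e) * (\<Sum>p\<in>?S. \<Sum>q\<in>?S. measure lborel (?J \<inter> ?E p q))"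
    unfolding sum_distrib_left[of 96] using coll e by (intro diff_left_mono mult_left_mono sum_mono) auto
  also have "\<dots> = (\<integral>\<theta>. 2 * a * indicator ?J \<theta> - a\<^sup>2 * (2 / ?e) * (\<Sum>p\<in>?S. \<Sum>q\<in>?S. indicator (?J \<inter> ?E p q) \<theta>) \<partial>lborel)"
  proof -
    have "(\<integral>\<theta>. indicat_real (?J \<inter> ?E p q) \<theta> \<partial>lborel) = measure lborel (?J \<inter> ?E p q)" for p q
      by simp
    moreover have "(\<integral>\<theta>. indicat_real ?J \<theta> \<partial>lborel) = 1" by simp
    ultimately show ?thesis using int_J int_JE
      by (simp only: Bochner_Integration.integral_diff Bochner_Integration.integral_sum
          integral_mult_right_zero integrable_mult_right Bochner_Integration.integrable_sum mult_1_right)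
  qed
  also have "\<dots> \<le> Fav (rand_set L \<omega> n)"
    unfolding Fav_eq
  proof (rule integral_mono)
    show "integrable lborel (\<lambda>\<theta>. 2 * a * indicator ?J \<theta> - a\<^sup>2 * (2 / ?e) * (\<Sum>p\<in>?S. \<Sum>q\<in>?S. indicator (?J \<inter> ?E p q) \<theta>))"
      by (intro Bochner_Integration.integrable_diff integrable_mult_right Bochner_Integration.integrable_sum int_J int_JE)
    show "integrable lborel (\<lambda>\<theta>. indicator {0<..<pi} \<theta> * shadow \<theta> (rand_set L \<omega> n))"
      by (rule integrable_shadow[OF \<omega> L0])
    fix \<theta>
    show "2 * a * indicator ?J \<theta> - a\<^sup>2 * (2 / ?e) * (\<Sum>p\<in>?S. \<Sum>q\<in>?S. indicator (?J \<inter> ?E p q) \<theta>)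
        \<le> indicator {0<..<pi} \<theta> * shadow \<theta> (rand_set L \<omega> n)"
    proof (cases "\<theta> \<in> ?J")
      case True
      then have "\<theta> \<in> {0<..<pi}" using pi_gt3 by auto
      moreover have "indicat_real (?J \<inter> ?E p q) \<theta> = indicator (?E p q) \<theta>" for p q
        using True by (simp add: indicator_def)
      ultimately show ?thesis using shadow_ge[OF \<omega> L, of a n \<theta>] a True by simp
    next
      case False
      then have "indicat_real ?J \<theta> = 0" "indicat_real (?J \<inter> ?E p q) \<theta> = 0" for p q
        by (simp_all only: indicator_simps Int_iff not_False_eq_True simp_thms)
      then show ?thesis using shadow_nonneg[of \<theta>] by (simp only: sum.neutral_const mult_zero_right diff_self) simp
    qed
  qed
  finally show ?thesis by (simp add: D_def)
qed

section \<open>Averages over independent subtrees\<close>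

lemma prob_space_grid_space: "prob_space (grid_space X)"
  unfolding grid_space_def by (intro prob_space_PiM measure_pmf.prob_space_axioms)

lemma measurable_component_grid [measurable]: "(\<lambda>\<omega>. \<omega> p) \<in> grid_space X \<rightarrow>\<^sub>M measure_pmf X"
  unfolding grid_space_def by (rule measurable_component_singleton) simp

lemma AE_grid_component:
  assumes "\<And>A. A \<in> set_pmf X \<Longrightarrow> P A"
  shows "AE \<omega> in grid_space X. P (\<omega> p)"
  unfolding grid_space_def
  by (rule AE_PiM_component) (auto simp: measure_pmf.prob_space_axioms AE_measure_pmf_iff assms)

lemma distr_component: "distr (grid_space X) (measure_pmf X) (\<lambda>\<omega>. \<omega> p) = measure_pmf X"
  unfolding grid_space_def
  by (rule distr_PiM_component) (auto simp: measure_pmf.prob_space_axioms)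

lemma indep_vars_components:
  "prob_space.indep_vars (grid_space X) (\<lambda>_. measure_pmf X) (\<lambda>p \<omega>. \<omega> p) UNIV"
proof -
  interpret prob_space "grid_space X" by (rule prob_space_grid_space)
  have eq: "distr (grid_space X) (Pi\<^sub>M UNIV (\<lambda>_. measure_pmf X)) (\<lambda>\<omega>. \<lambda>p\<in>UNIV. \<omega> p) = Pi\<^sub>M UNIV (\<lambda>_. measure_pmf X)"
    by (simp add: grid_space_def distr_id2 restrict_UNIV)
  show ?thesis
  proof (rule indep_vars_iff_distr_eq_PiM'[THEN iffD2])
    show "distr (grid_space X) (Pi\<^sub>M UNIV (\<lambda>_. measure_pmf X)) (\<lambda>\<omega>. \<lambda>p\<in>UNIV. \<omega> p)
        = Pi\<^sub>M UNIV (\<lambda>p. distr (grid_space X) (measure_pmf X) (\<lambda>\<omega>. \<omega> p))"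
      unfolding distr_component by (rule eq)
  qed (rule UNIV_not_empty measurable_component_grid)+
qed

lemma measurable_subtree [measurable]: "subtree L R \<in> grid_space X \<rightarrow>\<^sub>M grid_space X"
proof -
  have "(\<lambda>\<omega>. \<lambda>p\<in>UNIV. \<omega> (child L R p)) \<in> grid_space X \<rightarrow>\<^sub>M Pi\<^sub>M UNIV (\<lambda>_. measure_pmf X)"
    by (intro measurable_restrict measurable_component_grid)
  then show ?thesis by (simp add: subtree_def[abs_def] grid_space_def restrict_UNIV)
qed

lemma distr_subtree:
  assumes "R \<in> {..<L} \<times> {..<L}"
  shows "distr (grid_space X) (grid_space X) (subtree L R) = grid_space X"
proof -
  have "inj_on (child L R) UNIV"
    using child_inj[OF assms assms] by (auto intro: inj_onI)
  then have "distr (Pi\<^sub>M UNIV (\<lambda>_. measure_pmf X)) (Pi\<^sub>M UNIV (\<lambda>_. measure_pmf X)) (\<lambda>\<omega>. \<lambda>p\<in>UNIV. \<omega> (child L R p))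
      = Pi\<^sub>M UNIV (\<lambda>_. measure_pmf X)"
    by (intro distr_PiM_reindex) (auto simp: measure_pmf.prob_space_axioms)
  then show ?thesis by (simp add: grid_space_def subtree_def[abs_def] restrict_UNIV)
qed

lemma integral_subtree:
  fixes \<Phi> :: "_ \<Rightarrow> real"
  assumes "R \<in> {..<L} \<times> {..<L}" and [measurable]: "\<Phi> \<in> borel_measurable (grid_space X)"
  shows "(\<integral>\<omega>. \<Phi> (subtree L R \<omega>) \<partial>grid_space X) = (\<integral>\<omega>. \<Phi> \<omega> \<partial>grid_space X)"
proof -
  have "(\<integral>\<omega>. \<Phi> \<omega> \<partial>grid_space X) = (\<integral>\<omega>. \<Phi> \<omega> \<partial>distr (grid_space X) (grid_space X) (subtree L R))"
    by (simp only: distr_subtree[OF assms(1)])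
  also have "\<dots> = (\<integral>\<omega>. \<Phi> (subtree L R \<omega>) \<partial>grid_space X)"
    by (rule integral_distr) auto
  finally show ?thesis ..
qed

text \<open>The root and the subtrees of a deterministic family S read pairwise disjoint sets of
  coordinates, hence are independent. The squares actually selected form a random set, so selection
  has to enter through the weight g of the root value.\<close>

lemma integral_root_subtrees:
  fixes g :: "(nat \<times> nat) set \<Rightarrow> real" and \<Phi> :: "nat \<times> nat \<Rightarrow> (nat \<times> nat \<times> nat \<Rightarrow> (nat \<times> nat) set) \<Rightarrow> real"
  assumes S: "S \<subseteq> {..<L} \<times> {..<L}"
    and \<Phi> [measurable]: "\<And>R. \<Phi> R \<in> borel_measurable (grid_space X)"
    and bnd: "\<And>A. \<bar>g A\<bar> \<le> C" "\<And>R \<omega>. \<bar>\<Phi> R \<omega>\<bar> \<le> C"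
  shows "(\<integral>\<omega>. g (\<omega> (0, 0, 0)) * (\<Prod>R\<in>S. \<Phi> R (subtree L R \<omega>)) \<partial>grid_space X)
    = (\<integral>\<omega>. g (\<omega> (0, 0, 0)) \<partial>grid_space X) * (\<Prod>R\<in>S. \<integral>\<omega>. \<Phi> R \<omega> \<partial>grid_space X)"
proof -
  interpret prob_space "grid_space X" by (rule prob_space_grid_space)
  have fin: "finite S" using S by (rule finite_subset) auto
  \<comment> \<open>\<open>None\<close> stands for the root and \<open>Some R\<close> for the
    subtree at R; K gives the coordinates that are read, Y what is computed from them.\<close>
  define K where "K = case_option {(0, 0, 0)} (\<lambda>R. range (child L R))"
  define Y where "Y = case_option (\<lambda>\<eta>. g (\<eta> (0, 0, 0))) (\<lambda>R \<eta>. \<Phi> R (\<lambda>p. \<eta> (child L R p)))"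
  let ?J = "insert None (Some ` S)"
  have disj: "disjoint_family_on K ?J"
    unfolding disjoint_family_on_def
  proof (intro ballI impI)
    fix u v assume uv: "u \<in> ?J" "v \<in> ?J" "u \<noteq> v"
    have 1: "(0, 0, 0) \<noteq> child L R p" for R p by (metis child_ne_0)
    have 2: "child L R p \<noteq> child L R' p'" if "R \<in> S" "R' \<in> S" "R \<noteq> R'" for R R' p p'
      using child_inj[of R L R' p p'] that S by blast
    show "K u \<inter> K v = {}"
    proof (rule ccontr)
      assume "K u \<inter> K v \<noteq> {}"
      then obtain x where x: "x \<in> K u" "x \<in> K v" by blast
      have K_None: "y = (0, 0, 0)" if "y \<in> K None" for y
        using that by (simp add: K_def)
      have K_Some: "\<exists>p. y = child L R p" if "y \<in> K (Some R)" for y R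
        using that unfolding K_def option.case by blast
      show False
        using uv x K_None K_Some 1 2 by (cases u; cases v) (metis, metis, metis, (metis option.inject imageE insertE option.distinct(1)))
    qed
  qed
  have "indep_vars (\<lambda>j. Pi\<^sub>M (K j) (\<lambda>_. measure_pmf X)) (\<lambda>j \<omega>. restrict (\<lambda>p. \<omega> p) (K j)) ?J"
    using indep_vars_components disj by (intro indep_vars_restrict) auto
  then have indep: "indep_vars (\<lambda>_. borel) (\<lambda>j \<omega>. Y j (restrict (\<lambda>p. \<omega> p) (K j))) ?J"
  proof (rule indep_vars_compose2)
    fix j assume "j \<in> ?J"
    show "Y j \<in> borel_measurable (Pi\<^sub>M (K j) (\<lambda>_. measure_pmf X))"
    proof (cases j)
      case None
      have "(\<lambda>\<eta>. \<eta> (0, 0, 0)) \<in> Pi\<^sub>M (K j) (\<lambda>_. measure_pmf X) \<rightarrow>\<^sub>M measure_pmf X"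
        by (rule measurable_component_singleton) (simp add: K_def None)
      from measurable_compose[OF this, of g borel] show ?thesis by (simp add: Y_def None)
    next
      case (Some R)
      have "(\<lambda>\<eta>. \<lambda>p\<in>UNIV. \<eta> (child L R p)) \<in> Pi\<^sub>M (K j) (\<lambda>_. measure_pmf X) \<rightarrow>\<^sub>M Pi\<^sub>M UNIV (\<lambda>_. measure_pmf X)"
        by (intro measurable_restrict measurable_component_singleton) (simp add: K_def Some)
      then have "(\<lambda>\<eta> p. \<eta> (child L R p)) \<in> Pi\<^sub>M (K j) (\<lambda>_. measure_pmf X) \<rightarrow>\<^sub>M grid_space X"
        by (simp add: grid_space_def restrict_UNIV)
      from measurable_compose[OF this \<Phi>] show ?thesis by (simp add: Y_def Some)
    qed
  qed
  have Y_None: "Y None (restrict (\<lambda>p. \<omega> p) (K None)) = g (\<omega> (0, 0, 0))" for \<omega>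
    by (simp add: Y_def K_def)
  have Y_Some: "Y (Some R) (restrict (\<lambda>p. \<omega> p) (K (Some R))) = \<Phi> R (subtree L R \<omega>)" for R \<omega>
    by (simp add: Y_def K_def subtree_def)
  have int_Y: "integrable (grid_space X) (\<lambda>\<omega>. Y j (restrict (\<lambda>p. \<omega> p) (K j)))" if "j \<in> ?J" for j
  proof (rule integrable_const_bound[where B = C])
    show "(\<lambda>\<omega>. Y j (restrict (\<lambda>p. \<omega> p) (K j))) \<in> borel_measurable (grid_space X)"
      using indep that by (auto simp: indep_vars_def)
    show "AE \<omega> in grid_space X. norm (Y j (restrict (\<lambda>p. \<omega> p) (K j))) \<le> C"
      using bnd by (cases j) (auto simp: Y_None Y_Some)
  qed
  have "(\<integral>\<omega>. g (\<omega> (0, 0, 0)) * (\<Prod>R\<in>S. \<Phi> R (subtree L R \<omega>)) \<partial>grid_space X)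
      = (\<integral>\<omega>. (\<Prod>j\<in>?J. Y j (restrict (\<lambda>p. \<omega> p) (K j))) \<partial>grid_space X)"
    using fin by (simp add: prod.reindex Y_None Y_Some)
  also have "\<dots> = (\<Prod>j\<in>?J. \<integral>\<omega>. Y j (restrict (\<lambda>p. \<omega> p) (K j)) \<partial>grid_space X)"
    using fin indep int_Y by (intro indep_vars_lebesgue_integral) auto
  also have "\<dots> = (\<integral>\<omega>. g (\<omega> (0, 0, 0)) \<partial>grid_space X) * (\<Prod>R\<in>S. \<integral>\<omega>. \<Phi> R (subtree L R \<omega>) \<partial>grid_space X)"
    using fin by (simp add: prod.reindex Y_None Y_Some)
  also have "(\<Prod>R\<in>S. \<integral>\<omega>. \<Phi> R (subtree L R \<omega>) \<partial>grid_space X) = (\<Prod>R\<in>S. \<integral>\<omega>. \<Phi> R \<omega> \<partial>grid_space X)"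
    using S by (intro prod.cong refl integral_subtree) auto
  finally show ?thesis .
qed

section \<open>The averaging operator over selected subtrees\<close>

locale regular_grid_model =
  fixes L :: nat and X :: "(nat \<times> nat) set pmf"
  assumes L_ge: "2 \<le> L"
    and support: "\<And>A. A \<in> set_pmf X \<Longrightarrow> A \<subseteq> {..<L} \<times> {..<L} \<and> card A = L"
begin

sublocale prob_space "grid_space X" by (rule prob_space_grid_space)

lemma L_pos: "0 < L" using L_ge by simp

lemma AE_good: "AE \<omega> in grid_space X. \<omega> \<in> good L"
proof -
  have "AE \<omega> in grid_space X. \<forall>p. \<omega> p \<subseteq> {..<L} \<times> {..<L} \<and> card (\<omega> p) = L"
    unfolding AE_all_countable
    using AE_grid_component[of X "\<lambda>A. A \<subseteq> {..<L} \<times> {..<L} \<and> card A = L", OF support] by blast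
  then show ?thesis by (simp add: good_def)
qed

definition bounded_rv :: "((nat \<times> nat \<times> nat \<Rightarrow> (nat \<times> nat) set) \<Rightarrow> real) \<Rightarrow> bool" where
  "bounded_rv \<Phi> \<longleftrightarrow> \<Phi> \<in> borel_measurable (grid_space X) \<and> (\<exists>C. \<forall>\<omega>. \<bar>\<Phi> \<omega>\<bar> \<le> C)"

lemma prob_UNIV [simp]: "prob UNIV = 1"
  using prob_space by simp

lemma bounded_rv_integrable:
  assumes "bounded_rv \<Phi>"
  shows "integrable (grid_space X) \<Phi>"
proof -
  obtain C where "\<Phi> \<in> borel_measurable (grid_space X)" and "\<bar>\<Phi> \<omega>\<bar> \<le> C" for \<omega>
    using assms unfolding bounded_rv_def by blast
  then show ?thesis by (intro integrable_const_bound[where B = C]) auto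
qed

lemma bounded_rv_diff_const: "bounded_rv \<Phi> \<Longrightarrow> bounded_rv (\<lambda>\<omega>. \<Phi> \<omega> - c)"
  unfolding bounded_rv_def
proof (elim conjE exE, intro conjI exI allI)
  fix C \<omega> assume "\<forall>\<omega>. \<bar>\<Phi> \<omega>\<bar> \<le> C"
  then have "\<bar>\<Phi> \<omega>\<bar> \<le> C" by blast
  then show "\<bar>\<Phi> \<omega> - c\<bar> \<le> C + \<bar>c\<bar>" by linarith
qed auto

lemma bounded_rv_square: "bounded_rv \<Phi> \<Longrightarrow> bounded_rv (\<lambda>\<omega>. (\<Phi> \<omega>)\<^sup>2)"
  unfolding bounded_rv_def
proof (elim conjE exE, intro conjI exI allI)
  fix C \<omega> assume "\<forall>\<omega>. \<bar>\<Phi> \<omega>\<bar> \<le> C"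
  then have "\<bar>\<Phi> \<omega>\<bar>\<^sup>2 \<le> C\<^sup>2" by (intro power_mono) auto
  then show "\<bar>(\<Phi> \<omega>)\<^sup>2\<bar> \<le> C\<^sup>2" by simp
qed auto

lemma second_moment_eq:
  assumes "bounded_rv \<Phi>"
  shows "expectation (\<lambda>\<omega>. (\<Phi> \<omega> - expectation \<Phi>)\<^sup>2) = expectation (\<lambda>\<omega>. (\<Phi> \<omega>)\<^sup>2) - (expectation \<Phi>)\<^sup>2"
  using assms by (intro variance_eq bounded_rv_integrable bounded_rv_square)

lemma expectation_abs_le:
  assumes "bounded_rv \<Phi>"
  shows "expectation (\<lambda>\<omega>. \<bar>\<Phi> \<omega>\<bar>) \<le> sqrt (expectation (\<lambda>\<omega>. (\<Phi> \<omega>)\<^sup>2))"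
proof -
  have "bounded_rv (\<lambda>\<omega>. \<bar>\<Phi> \<omega>\<bar>)" using assms by (auto simp: bounded_rv_def)
  from second_moment_eq[OF this] have "(expectation (\<lambda>\<omega>. \<bar>\<Phi> \<omega>\<bar>))\<^sup>2 \<le> expectation (\<lambda>\<omega>. (\<Phi> \<omega>)\<^sup>2)"
    using variance_positive[of "\<lambda>\<omega>. \<bar>\<Phi> \<omega>\<bar>"] by simp
  then show ?thesis by (rule real_le_rsqrt)
qed

text \<open>Summing over all squares with indicators, rather than over the random set
  \<open>\<omega> (0, 0, 0)\<close>, exposes fixed squares to which independence applies. On
  \<open>good L\<close> this is the plain average over the selected squares.\<close>

definition avg :: "((nat \<times> nat \<times> nat \<Rightarrow> (nat \<times> nat) set) \<Rightarrow> real) \<Rightarrow> (nat \<times> nat \<times> nat \<Rightarrow> (nat \<times> nat) set) \<Rightarrow> real" where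
  "avg \<Phi> \<omega> = (\<Sum>R\<in>{..<L} \<times> {..<L}. of_bool (R \<in> \<omega> (0, 0, 0)) * \<Phi> (subtree L R \<omega>)) / real L"

lemma avg_good:
  assumes "\<omega> \<in> good L"
  shows "avg \<Phi> \<omega> = (\<Sum>R\<in>\<omega> (0, 0, 0). \<Phi> (subtree L R \<omega>)) / real L"
proof -
  have "\<omega> (0, 0, 0) \<subseteq> {..<L} \<times> {..<L}" using assms unfolding good_def by blast
  then have "(\<Sum>R\<in>\<omega> (0, 0, 0). of_bool (R \<in> \<omega> (0, 0, 0)) * \<Phi> (subtree L R \<omega>))
      = (\<Sum>R\<in>{..<L} \<times> {..<L}. of_bool (R \<in> \<omega> (0, 0, 0)) * \<Phi> (subtree L R \<omega>))"
    by (intro sum.mono_neutral_left) auto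
  then show ?thesis by (simp add: avg_def)
qed

lemma bounded_rv_avg:
  assumes "bounded_rv \<Phi>"
  shows "bounded_rv (avg \<Phi>)"
proof -
  obtain C where [measurable]: "\<Phi> \<in> borel_measurable (grid_space X)" and C: "\<bar>\<Phi> \<omega>\<bar> \<le> C" for \<omega>
    using assms unfolding bounded_rv_def by blast
  have "\<bar>avg \<Phi> \<omega>\<bar> \<le> (\<Sum>R\<in>{..<L} \<times> {..<L}. C) / real L" for \<omega>
  proof -
    have "0 \<le> C" using C[of undefined] by simp
    then have "\<bar>of_bool (R \<in> \<omega> (0, 0, 0)) * \<Phi> (subtree L R \<omega>)\<bar> \<le> C" for R
      using C[of "subtree L R \<omega>"] by simp
    then have "\<bar>\<Sum>R\<in>{..<L} \<times> {..<L}. of_bool (R \<in> \<omega> (0, 0, 0)) * \<Phi> (subtree L R \<omega>)\<bar> \<le> (\<Sum>R\<in>{..<L} \<times> {..<L}. C)"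
      by (intro order_trans[OF sum_abs] sum_mono)
    then show ?thesis unfolding avg_def abs_divide abs_of_nat by (intro divide_right_mono) auto
  qed
  moreover have "avg \<Phi> \<in> borel_measurable (grid_space X)"
  proof -
    have "(\<lambda>\<omega>. of_bool (R \<in> \<omega> (0, 0, 0)) :: real) \<in> borel_measurable (grid_space X)" for R
      by (rule measurable_compose[OF measurable_component_grid]) simp
    moreover have "(\<lambda>\<omega>. \<Phi> (subtree L R \<omega>)) \<in> borel_measurable (grid_space X)" for R
      by measurable
    ultimately show ?thesis unfolding avg_def[abs_def]
      by (intro borel_measurable_divide borel_measurable_sum borel_measurable_times) auto
  qed
  ultimately show ?thesis unfolding bounded_rv_def by blast
qed

lemma sum_prob_root: "(\<Sum>R\<in>{..<L} \<times> {..<L}. expectation (\<lambda>\<omega>. of_bool (R \<in> \<omega> (0, 0, 0)))) = real L"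
proof -
  have meas: "(\<lambda>\<omega>. of_bool (R \<in> \<omega> (0, 0, 0)) :: real) \<in> borel_measurable (grid_space X)" for R
    by (rule measurable_compose[OF measurable_component_grid]) simp
  have int: "integrable (grid_space X) (\<lambda>\<omega>. of_bool (R \<in> \<omega> (0, 0, 0)) :: real)" for R
    by (rule integrable_const_bound[where B = 1]) (use meas in auto)
  have "(\<Sum>R\<in>{..<L} \<times> {..<L}. expectation (\<lambda>\<omega>. of_bool (R \<in> \<omega> (0, 0, 0)) :: real))
      = expectation (\<lambda>\<omega>. \<Sum>R\<in>{..<L} \<times> {..<L}. of_bool (R \<in> \<omega> (0, 0, 0)))"
    by (intro Bochner_Integration.integral_sum[symmetric] int)
  also have "\<dots> = expectation (\<lambda>\<omega>. real L)"
  proof (intro integral_cong_AE)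
    show "AE \<omega> in grid_space X. (\<Sum>R\<in>{..<L} \<times> {..<L}. of_bool (R \<in> \<omega> (0, 0, 0))) = real L"
      using AE_good
    proof eventually_elim
      case (elim \<omega>)
      have "(\<Sum>R\<in>{..<L} \<times> {..<L}. of_bool (R \<in> \<omega> (0, 0, 0))) = real L * avg (\<lambda>_. 1) \<omega>"
        using L_pos by (simp add: avg_def)
      also have "\<dots> = real L" using L_pos by (simp add: avg_good[OF elim] good_card[OF elim])
      finally show ?case .
    qed
  qed (intro borel_measurable_sum borel_measurable_const meas)+
  finally show ?thesis by (simp add: prob_space)
qed

lemma expectation_root_subtree:
  assumes "bounded_rv \<Phi>" "R \<in> {..<L} \<times> {..<L}"
  shows "expectation (\<lambda>\<omega>. of_bool (R \<in> \<omega> (0, 0, 0)) * \<Phi> (subtree L R \<omega>))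
    = expectation (\<lambda>\<omega>. of_bool (R \<in> \<omega> (0, 0, 0))) * expectation \<Phi>"
proof -
  obtain C where meas: "\<Phi> \<in> borel_measurable (grid_space X)" and C: "\<bar>\<Phi> \<omega>\<bar> \<le> C" for \<omega>
    using assms unfolding bounded_rv_def by blast
  show ?thesis
    using integral_root_subtrees[of "{R}" L "\<lambda>_. \<Phi>" X "\<lambda>A. of_bool (R \<in> A)" "max 1 C"] assms(2) C meas
    by (simp add: le_max_iff_disj)
qed

lemma expectation_root_two_subtrees:
  assumes "bounded_rv \<Phi>" "R \<in> {..<L} \<times> {..<L}" "R' \<in> {..<L} \<times> {..<L}" "R \<noteq> R'"
  shows "expectation (\<lambda>\<omega>. of_bool (R \<in> \<omega> (0, 0, 0)) * \<Phi> (subtree L R \<omega>) * (of_bool (R' \<in> \<omega> (0, 0, 0)) * \<Phi> (subtree L R' \<omega>)))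
    = expectation (\<lambda>\<omega>. of_bool (R \<in> \<omega> (0, 0, 0) \<and> R' \<in> \<omega> (0, 0, 0))) * (expectation \<Phi>)\<^sup>2"
proof -
  obtain C where meas: "\<Phi> \<in> borel_measurable (grid_space X)" and C: "\<bar>\<Phi> \<omega>\<bar> \<le> C" for \<omega>
    using assms unfolding bounded_rv_def by blast
  have main: "expectation (\<lambda>\<omega>. of_bool (R \<in> \<omega> (0, 0, 0) \<and> R' \<in> \<omega> (0, 0, 0)) * (\<Prod>R\<in>{R, R'}. \<Phi> (subtree L R \<omega>)))
      = expectation (\<lambda>\<omega>. of_bool (R \<in> \<omega> (0, 0, 0) \<and> R' \<in> \<omega> (0, 0, 0))) * (\<Prod>R\<in>{R, R'}. expectation \<Phi>)"
    using assms C meas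
    by (intro integral_root_subtrees[of "{R, R'}" L "\<lambda>_. \<Phi>" X "\<lambda>A. of_bool (R \<in> A \<and> R' \<in> A)" "max 1 C"])
      (auto simp: le_max_iff_disj)
  have eq: "of_bool (R \<in> \<omega> (0, 0, 0)) * \<Phi> (subtree L R \<omega>) * (of_bool (R' \<in> \<omega> (0, 0, 0)) * \<Phi> (subtree L R' \<omega>))
      = of_bool (R \<in> \<omega> (0, 0, 0) \<and> R' \<in> \<omega> (0, 0, 0)) * (\<Prod>R\<in>{R, R'}. \<Phi> (subtree L R \<omega>))" for \<omega>
    using assms(4) by (simp add: of_bool_conj)
  show ?thesis unfolding eq main using assms(4) by (simp add: power2_eq_square)
qed

lemma bounded_rv_root_subtree:
  assumes "bounded_rv \<Phi>"
  shows "bounded_rv (\<lambda>\<omega>. of_bool (R \<in> \<omega> (0, 0, 0)) * \<Phi> (subtree L R \<omega>))"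
proof -
  obtain C where [measurable]: "\<Phi> \<in> borel_measurable (grid_space X)" and C: "\<bar>\<Phi> \<omega>\<bar> \<le> C" for \<omega>
    using assms unfolding bounded_rv_def by blast
  have "(\<lambda>\<omega>. of_bool (R \<in> \<omega> (0, 0, 0)) :: real) \<in> borel_measurable (grid_space X)"
    by (rule measurable_compose[OF measurable_component_grid]) simp
  moreover have "(\<lambda>\<omega>. \<Phi> (subtree L R \<omega>)) \<in> borel_measurable (grid_space X)"
    by measurable
  moreover have "0 \<le> C" using C[of undefined] by simp
  then have "\<bar>of_bool (R \<in> \<omega> (0, 0, 0)) * \<Phi> (subtree L R \<omega>)\<bar> \<le> C" for \<omega>
    using C[of "subtree L R \<omega>"] by simp
  ultimately show ?thesis unfolding bounded_rv_def by (intro conjI exI allI borel_measurable_times)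
qed

lemma bounded_rv_mult: "bounded_rv \<Phi> \<Longrightarrow> bounded_rv \<Psi> \<Longrightarrow> bounded_rv (\<lambda>\<omega>. \<Phi> \<omega> * \<Psi> \<omega>)"
  unfolding bounded_rv_def
proof (elim conjE exE, intro conjI exI allI)
  fix C D \<omega> assume 1: "\<forall>\<omega>. \<bar>\<Phi> \<omega>\<bar> \<le> C" "\<forall>\<omega>. \<bar>\<Psi> \<omega>\<bar> \<le> D"
  have "0 \<le> C" using 1(1) abs_ge_zero order_trans by blast
  then show "\<bar>\<Phi> \<omega> * \<Psi> \<omega>\<bar> \<le> C * D" using 1 unfolding abs_mult by (intro mult_mono) auto
qed auto

lemma expectation_avg:
  assumes "bounded_rv \<Phi>"
  shows "expectation (avg \<Phi>) = expectation \<Phi>"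
proof -
  have "expectation (avg \<Phi>) = (\<Sum>R\<in>{..<L} \<times> {..<L}. expectation (\<lambda>\<omega>. of_bool (R \<in> \<omega> (0, 0, 0)) * \<Phi> (subtree L R \<omega>))) / real L"
    unfolding avg_def[abs_def] using assms
    by (subst Bochner_Integration.integral_divide_zero, subst Bochner_Integration.integral_sum)
      (auto intro!: bounded_rv_integrable bounded_rv_root_subtree)
  also have "\<dots> = (\<Sum>R\<in>{..<L} \<times> {..<L}. expectation (\<lambda>\<omega>. of_bool (R \<in> \<omega> (0, 0, 0))) * expectation \<Phi>) / real L"
    by (simp only: expectation_root_subtree[OF assms] cong: sum.cong)
  also have "\<dots> = expectation \<Phi>"
    unfolding sum_distrib_right[symmetric] sum_prob_root using L_pos by simp
  finally show ?thesis .
qed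

text \<open>The selections of different squares may be correlated, but the mixed terms vanish: the
  two subtrees are independent of each other and of the root, and \<Phi> has mean zero. In the
  diagonal terms the selection probabilities add up to L.\<close>

lemma second_moment_avg_centered:
  assumes \<Phi>: "bounded_rv \<Phi>" and "expectation \<Phi> = 0"
  shows "expectation (\<lambda>\<omega>. (avg \<Phi> \<omega>)\<^sup>2) = expectation (\<lambda>\<omega>. (\<Phi> \<omega>)\<^sup>2) / real L"
proof -
  let ?D = "{..<L} \<times> {..<L}"
  let ?Y = "\<lambda>R \<omega>. of_bool (R \<in> \<omega> (0, 0, 0)) * \<Phi> (subtree L R \<omega>)"
  have int: "integrable (grid_space X) (\<lambda>\<omega>. ?Y R \<omega> * ?Y R' \<omega>)" for R R'
    by (intro bounded_rv_integrable bounded_rv_mult bounded_rv_root_subtree \<Phi>)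
  have inner: "(\<Sum>R'\<in>?D. expectation (\<lambda>\<omega>. ?Y R \<omega> * ?Y R' \<omega>))
      = expectation (\<lambda>\<omega>. of_bool (R \<in> \<omega> (0, 0, 0))) * expectation (\<lambda>\<omega>. (\<Phi> \<omega>)\<^sup>2)" if "R \<in> ?D" for R
  proof -
    have "(\<Sum>R'\<in>?D. expectation (\<lambda>\<omega>. ?Y R \<omega> * ?Y R' \<omega>)) = (\<Sum>R'\<in>{R}. expectation (\<lambda>\<omega>. ?Y R \<omega> * ?Y R' \<omega>))"
    proof (rule sum.mono_neutral_right)
      show "\<forall>R'\<in>?D - {R}. expectation (\<lambda>\<omega>. ?Y R \<omega> * ?Y R' \<omega>) = 0"
      proof
        fix R' assume "R' \<in> ?D - {R}"
        then show "expectation (\<lambda>\<omega>. ?Y R \<omega> * ?Y R' \<omega>) = 0"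
          using expectation_root_two_subtrees[OF \<Phi> that, of R'] assms(2) by auto
      qed
    qed (use that in auto)
    also have "\<dots> = expectation (\<lambda>\<omega>. of_bool (R \<in> \<omega> (0, 0, 0)) * (\<Phi> (subtree L R \<omega>))\<^sup>2)"
    proof -
      have "of_bool (R \<in> \<omega> (0, 0, 0)) * (\<Phi> (subtree L R \<omega>))\<^sup>2 = ?Y R \<omega> * ?Y R \<omega>" for \<omega>
        by (cases "R \<in> \<omega> (0, 0, 0)") (simp_all add: power2_eq_square)
      then show ?thesis by (simp only:) simp
    qed
    also have "\<dots> = expectation (\<lambda>\<omega>. of_bool (R \<in> \<omega> (0, 0, 0))) * expectation (\<lambda>\<omega>. (\<Phi> \<omega>)\<^sup>2)"
      by (rule expectation_root_subtree[OF bounded_rv_square[OF \<Phi>] that])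
    finally show ?thesis .
  qed
  have "expectation (\<lambda>\<omega>. (avg \<Phi> \<omega>)\<^sup>2) = expectation (\<lambda>\<omega>. (\<Sum>R\<in>?D. \<Sum>R'\<in>?D. ?Y R \<omega> * ?Y R' \<omega>) / (real L)\<^sup>2)"
    unfolding avg_def by (simp only: power_divide power2_eq_square[of "sum _ _"] sum_product)
  also have "\<dots> = (\<Sum>R\<in>?D. \<Sum>R'\<in>?D. expectation (\<lambda>\<omega>. ?Y R \<omega> * ?Y R' \<omega>)) / (real L)\<^sup>2"
    using int by (simp only: integral_divide_zero Bochner_Integration.integral_sum Bochner_Integration.integrable_sum)
  also have "\<dots> = (\<Sum>R\<in>?D. expectation (\<lambda>\<omega>. of_bool (R \<in> \<omega> (0, 0, 0))) * expectation (\<lambda>\<omega>. (\<Phi> \<omega>)\<^sup>2)) / (real L)\<^sup>2"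
    by (simp only: inner cong: sum.cong)
  also have "\<dots> = expectation (\<lambda>\<omega>. (\<Phi> \<omega>)\<^sup>2) / real L"
    unfolding sum_distrib_right[symmetric] sum_prob_root using L_pos by (simp add: power2_eq_square)
  finally show ?thesis .
qed

text \<open>Averaging commutes with subtracting a constant because almost surely exactly L squares
  are selected; this reduces the claim to the centred case. A random number of squares would
  contribute a fluctuation of its own.\<close>

lemma variance_avg:
  assumes \<Phi>: "bounded_rv \<Phi>"
  shows "variance (avg \<Phi>) = variance \<Phi> / real L"
proof -
  let ?\<mu> = "expectation \<Phi>"
  have c: "bounded_rv (\<lambda>\<omega>. \<Phi> \<omega> - ?\<mu>)" using \<Phi> by (rule bounded_rv_diff_const)
  have "expectation (\<lambda>\<omega>. \<Phi> \<omega> - ?\<mu>) = 0"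
    using bounded_rv_integrable[OF \<Phi>] by (simp add: Bochner_Integration.integral_diff prob_space)
  from second_moment_avg_centered[OF c this]
  have "expectation (\<lambda>\<omega>. (avg (\<lambda>\<omega>. \<Phi> \<omega> - ?\<mu>) \<omega>)\<^sup>2) = variance \<Phi> / real L" .
  moreover have "expectation (\<lambda>\<omega>. (avg (\<lambda>\<omega>. \<Phi> \<omega> - ?\<mu>) \<omega>)\<^sup>2) = expectation (\<lambda>\<omega>. (avg \<Phi> \<omega> - ?\<mu>)\<^sup>2)"
  proof (rule integral_cong_AE)
    show "AE \<omega> in grid_space X. (avg (\<lambda>\<omega>. \<Phi> \<omega> - ?\<mu>) \<omega>)\<^sup>2 = (avg \<Phi> \<omega> - ?\<mu>)\<^sup>2"
      using AE_good
    proof eventually_elim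
      case (elim \<omega>)
      have "avg (\<lambda>\<omega>. \<Phi> \<omega> - ?\<mu>) \<omega> = avg \<Phi> \<omega> - ?\<mu>"
        unfolding avg_good[OF elim] sum_subtractf sum_constant good_card[OF elim] diff_divide_distrib
        using L_pos by simp
      then show ?case by simp
    qed
    show "(\<lambda>\<omega>. (avg (\<lambda>\<omega>. \<Phi> \<omega> - ?\<mu>) \<omega>)\<^sup>2) \<in> borel_measurable (grid_space X)"
      "(\<lambda>\<omega>. (avg \<Phi> \<omega> - ?\<mu>)\<^sup>2) \<in> borel_measurable (grid_space X)"
      using bounded_rv_square[OF bounded_rv_avg[OF c]] bounded_rv_square[OF bounded_rv_diff_const[OF bounded_rv_avg[OF \<Phi>]]]
      by (auto simp: bounded_rv_def)
  qed
  ultimately show ?thesis by (simp add: expectation_avg[OF \<Phi>])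
qed

lemma avg_iterate:
  assumes \<Phi>: "bounded_rv \<Phi>"
  shows "bounded_rv ((avg ^^ k) \<Phi>) \<and> expectation ((avg ^^ k) \<Phi>) = expectation \<Phi>
    \<and> variance ((avg ^^ k) \<Phi>) = variance \<Phi> / real L ^ k"
proof (induction k)
  case (Suc k)
  then have b: "bounded_rv ((avg ^^ k) \<Phi>)" and IH: "expectation ((avg ^^ k) \<Phi>) = expectation \<Phi>"
    "variance ((avg ^^ k) \<Phi>) = variance \<Phi> / real L ^ k" by blast+
  note * = bounded_rv_avg[OF b] expectation_avg[OF b] variance_avg[OF b]
  show ?case unfolding funpow.simps o_apply using * IH(2)[unfolded IH(1)] by (simp add: IH(1))
qed (simp add: \<Phi>)

lemma avg_mono:
  assumes "\<omega> \<in> good L" "\<And>\<omega>. \<omega> \<in> good L \<Longrightarrow> \<Phi> \<omega> \<le> \<Psi> \<omega>"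
  shows "avg \<Phi> \<omega> \<le> avg \<Psi> \<omega>"
  unfolding avg_good[OF assms(1)] by (intro divide_right_mono sum_mono assms(2) subtree_good[OF assms(1)]) simp

text \<open>Off the almost sure set \<open>good L\<close> the Favard length is unbounded; the truncation makes it a
  bounded random variable without changing it on \<open>good L\<close>.\<close>

definition F :: "nat \<Rightarrow> (nat \<times> nat \<times> nat \<Rightarrow> (nat \<times> nat) set) \<Rightarrow> real" where
  "F n \<omega> = min (4 * pi) (Fav (rand_set L \<omega> n))"

definition m :: "nat \<Rightarrow> real" where "m n = expectation (F n)"

lemma F_good: "\<omega> \<in> good L \<Longrightarrow> F n \<omega> = Fav (rand_set L \<omega> n)"
  unfolding F_def using Fav_le[OF _ L_pos] by (intro min_absorb2)

lemma measurable_F: "F n \<in> borel_measurable (grid_space X)"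
  unfolding F_def[abs_def] using measurable_Fav[OF L_pos] by (intro borel_measurable_min) auto

lemma F_nonneg: "0 \<le> F n \<omega>"
  using Fav_nonneg by (simp add: F_def)

lemma bounded_rv_F: "bounded_rv (F n)"
  unfolding bounded_rv_def
proof (intro conjI exI allI)
  show "\<bar>F n \<omega>\<bar> \<le> 4 * pi" for \<omega>
    using F_nonneg[of n \<omega>] by (simp add: F_def)
qed (rule measurable_F)

lemma expectation_Fav: "expectation (\<lambda>\<omega>. Fav (rand_set L \<omega> n)) = m n"
  unfolding m_def
proof (rule integral_cong_AE)
  show "AE \<omega> in grid_space X. Fav (rand_set L \<omega> n) = F n \<omega>"
    using AE_good by eventually_elim (rule F_good[symmetric])
qed (use measurable_F measurable_Fav[OF L_pos] in auto)

lemma expectation_mono_good: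
  assumes "bounded_rv \<Phi>" "bounded_rv \<Psi>" "\<And>\<omega>. \<omega> \<in> good L \<Longrightarrow> \<Phi> \<omega> \<le> \<Psi> \<omega>"
  shows "expectation \<Phi> \<le> expectation \<Psi>"
proof (rule integral_mono_AE)
  show "AE \<omega> in grid_space X. \<Phi> \<omega> \<le> \<Psi> \<omega>"
    using AE_good by eventually_elim (rule assms(3))
qed (use assms bounded_rv_integrable in auto)

section \<open>Comparison of the Favard length with its averages\<close>

lemma F_Suc_le: "\<omega> \<in> good L \<Longrightarrow> F (Suc n) \<omega> \<le> avg (F n) \<omega>"
  using Fav_Suc(1)[OF _ L_pos, of \<omega> n] by (simp add: F_good avg_good subtree_good)

lemma F_le_avg_iterate: "\<omega> \<in> good L \<Longrightarrow> F (k + j) \<omega> \<le> (avg ^^ k) (F j) \<omega>"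
proof (induction k arbitrary: \<omega>)
  case (Suc k)
  have "F (Suc k + j) \<omega> \<le> avg (F (k + j)) \<omega>" using F_Suc_le[OF Suc.prems] by simp
  also have "\<dots> \<le> avg ((avg ^^ k) (F j)) \<omega>" by (intro avg_mono Suc)
  finally show ?case by simp
qed simp

lemma excess_antimono:
  "\<omega> \<in> good L \<Longrightarrow> avg (F (Suc n)) \<omega> - F (Suc (Suc n)) \<omega> \<le> avg (F n) \<omega> - F (Suc n) \<omega>"
  using Fav_Suc(2)[OF _ L_pos, of \<omega> n] by (simp add: F_good avg_good subtree_good)

lemma bounded_rv_diff: "bounded_rv \<Phi> \<Longrightarrow> bounded_rv \<Psi> \<Longrightarrow> bounded_rv (\<lambda>\<omega>. \<Phi> \<omega> - \<Psi> \<omega>)"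
  unfolding bounded_rv_def
proof (elim conjE exE, intro conjI exI allI)
  fix C D \<omega> assume "\<forall>\<omega>. \<bar>\<Phi> \<omega>\<bar> \<le> C" "\<forall>\<omega>. \<bar>\<Psi> \<omega>\<bar> \<le> D"
  then have "\<bar>\<Phi> \<omega>\<bar> \<le> C" "\<bar>\<Psi> \<omega>\<bar> \<le> D" by blast+
  then show "\<bar>\<Phi> \<omega> - \<Psi> \<omega>\<bar> \<le> C + D" by linarith
qed auto

lemma expectation_diff:
  "bounded_rv \<Phi> \<Longrightarrow> bounded_rv \<Psi> \<Longrightarrow> expectation (\<lambda>\<omega>. \<Phi> \<omega> - \<Psi> \<omega>) = expectation \<Phi> - expectation \<Psi>"
  by (intro Bochner_Integration.integral_diff bounded_rv_integrable)

lemma convex_decay_m: "convex_decay m (1 / (1728 * real L))"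
proof
  show "0 < 1 / (1728 * real L)" using L_pos by simp
  fix n
  show "1 / (1728 * real L) / (real n + 1) \<le> m n"
  proof -
    have "expectation (\<lambda>_. 1 / (1728 * real L) / (real n + 1)) \<le> expectation (F n)"
    proof (rule expectation_mono_good[OF _ bounded_rv_F])
      show "1 / (1728 * real L) / (real n + 1) \<le> F n \<omega>" if "\<omega> \<in> good L" for \<omega>
        unfolding F_good[OF that] by (rule Fav_ge[OF that L_ge])
    qed (auto simp: bounded_rv_def)
    then show ?thesis by (simp add: m_def prob_space)
  qed
  show "m (Suc n) \<le> m n" unfolding m_def
    by (rule expectation_mono_good) (simp_all add: bounded_rv_F F_good Fav_antimono[OF _ L_pos])
  \<comment> \<open>The mean of \<open>avg (F n)\<close> is \<open>m n\<close>, so each decrement of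
    \<open>m\<close> is an expected overlap, and the overlap decreases along every good
    path.\<close>
  have eq: "m n - m (Suc n) = expectation (\<lambda>\<omega>. avg (F n) \<omega> - F (Suc n) \<omega>)" for n
    by (simp add: m_def expectation_diff bounded_rv_avg bounded_rv_F expectation_avg)
  show "m (Suc n) - m (Suc (Suc n)) \<le> m n - m (Suc n)"
    unfolding eq by (intro expectation_mono_good bounded_rv_diff bounded_rv_avg bounded_rv_F excess_antimono)
qed

sublocale convex_decay m "1 / (1728 * real L)" by (rule convex_decay_m)

text \<open>On good paths \<open>F (Suc n)\<close> lies between 0 and \<open>avg (F n)\<close>, so
  the squares compare; averaging keeps the mean and divides the variance by L, which is at least 2.
  This is the recursion for \<open>second_moment_le\<close>.\<close>

lemma second_moment_F_Suc_le:
  "expectation (\<lambda>\<omega>. (F (Suc n) \<omega>)\<^sup>2) \<le> (m n)\<^sup>2 + expectation (\<lambda>\<omega>. (F n \<omega>)\<^sup>2) / 2"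
proof -
  have "expectation (\<lambda>\<omega>. (F (Suc n) \<omega>)\<^sup>2) \<le> expectation (\<lambda>\<omega>. (avg (F n) \<omega>)\<^sup>2)"
    by (intro expectation_mono_good bounded_rv_square bounded_rv_avg bounded_rv_F power_mono F_Suc_le F_nonneg)
  also have "\<dots> = (m n)\<^sup>2 + variance (F n) / real L"
    using second_moment_eq[OF bounded_rv_avg[OF bounded_rv_F], of n]
      variance_avg[OF bounded_rv_F, of n] expectation_avg[OF bounded_rv_F, of n] by (simp add: m_def)
  also have "\<dots> \<le> (m n)\<^sup>2 + expectation (\<lambda>\<omega>. (F n \<omega>)\<^sup>2) / 2"
    using second_moment_eq[OF bounded_rv_F, of n] variance_positive[of "F n"] L_ge
    by (intro add_left_mono frac_le) auto
  finally show ?thesis .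
qed

text \<open>With j = n - k, the iterated average A dominates \<open>F n\<close> on good paths, so
  \<open>\<bar>F n \<omega> - m n\<bar>\<close> is at most
  \<open>\<bar>A \<omega> - m j\<bar>\<close> plus the nonnegative differences
  \<open>A \<omega> - F n \<omega>\<close> and \<open>m j - m n\<close>. The mean of the former
  difference equals the latter, whence the factor 2. The fluctuation of A is bounded by its standard
  deviation, and \<open>2 ^ k \<le> L ^ k\<close> gives the powers of \<open>sqrt 2\<close>.\<close>

lemma deviation_F_le:
  assumes K: "\<And>n. expectation (\<lambda>\<omega>. (F n \<omega>)\<^sup>2) \<le> K * (m n)\<^sup>2" and "0 < K" and "k \<le> n"
  shows "expectation (\<lambda>\<omega>. \<bar>F n \<omega> - m n\<bar>) \<le> (1 / sqrt 2) ^ k * (sqrt K * m (n - k)) + 2 * (m (n - k) - m n)"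
proof -
  define j where "j = n - k"
  have n: "n = k + j" using \<open>k \<le> n\<close> by (simp add: j_def)
  define A where "A = (avg ^^ k) (F j)"
  have A: "bounded_rv A" "expectation A = m j"
    using avg_iterate[OF bounded_rv_F, of k j] by (simp_all add: A_def m_def)
  have "variance A = variance (F j) / real L ^ k"
    using avg_iterate[OF bounded_rv_F, of k j] unfolding A_def by blast
  then have var_A: "expectation (\<lambda>\<omega>. (A \<omega> - m j)\<^sup>2) = variance (F j) / real L ^ k"
    unfolding A(2) .
  have mj: "m n \<le> m j" by (intro m_antimono) (simp add: n)
  have abs: "bounded_rv (\<lambda>\<omega>. \<bar>\<Phi> \<omega>\<bar>)" if "bounded_rv \<Phi>" for \<Phi>
    using that by (auto simp: bounded_rv_def)
  have bA: "bounded_rv (\<lambda>\<omega>. A \<omega> - m j)" using A(1) by (rule bounded_rv_diff_const)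
  have bR: "bounded_rv (\<lambda>\<omega>. \<bar>A \<omega> - m j\<bar> - (F n \<omega> - A \<omega> - (m j - m n)))"
    by (intro bounded_rv_diff abs bA bounded_rv_diff_const bounded_rv_F A(1))
  have "expectation (\<lambda>\<omega>. \<bar>F n \<omega> - m n\<bar>) \<le> expectation (\<lambda>\<omega>. \<bar>A \<omega> - m j\<bar> - (F n \<omega> - A \<omega> - (m j - m n)))"
  proof (rule expectation_mono_good)
    fix \<omega> assume "\<omega> \<in> good L"
    then have "F n \<omega> \<le> A \<omega>" unfolding n A_def by (rule F_le_avg_iterate)
    then show "\<bar>F n \<omega> - m n\<bar> \<le> \<bar>A \<omega> - m j\<bar> - (F n \<omega> - A \<omega> - (m j - m n))"
      using mj by linarith
  qed (intro abs bounded_rv_diff_const bounded_rv_F, rule bR)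
  also have "\<dots> = expectation (\<lambda>\<omega>. \<bar>A \<omega> - m j\<bar>) + 2 * (m j - m n)"
  proof -
    have "expectation (\<lambda>\<omega>. F n \<omega> - A \<omega> - (m j - m n)) = (m n - m j) - (m j - m n)"
      using bounded_rv_integrable[OF bounded_rv_diff[OF bounded_rv_F A(1)]]
      by (simp add: expectation_diff[OF bounded_rv_F A(1)] A(2) m_def)
    then show ?thesis
      using expectation_diff[OF abs[OF bA] bounded_rv_diff_const[OF bounded_rv_diff[OF bounded_rv_F A(1)]], of n "m j - m n"]
      by simp
  qed
  also have "expectation (\<lambda>\<omega>. \<bar>A \<omega> - m j\<bar>) \<le> (1 / sqrt 2) ^ k * (sqrt K * m j)"
  proof -
    note var_A
    also have "variance (F j) / real L ^ k \<le> (K * (m j)\<^sup>2) / 2 ^ k"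
      using second_moment_eq[OF bounded_rv_F, of j] K[of j] variance_positive[of "F j"] L_ge
      by (intro frac_le power_mono) (auto simp: zero_le_power2 intro: order_trans[OF _ K[of j]])
    finally have "sqrt (expectation (\<lambda>\<omega>. (A \<omega> - m j)\<^sup>2)) \<le> sqrt ((K * (m j)\<^sup>2) / 2 ^ k)"
      by (rule real_sqrt_le_mono)
    also have "\<dots> = (1 / sqrt 2) ^ k * (sqrt K * m j)"
      using m_pos[of j] by (simp add: real_sqrt_divide real_sqrt_mult real_sqrt_power power_one_over)
    finally show ?thesis using expectation_abs_le[OF bA] by linarith
  qed
  finally show ?thesis by (simp add: j_def)
qed

theorem Fav_ratio_tendsto:
  "AE \<omega> in grid_space X. (\<lambda>n. Fav (rand_set L \<omega> n) / expectation (\<lambda>\<omega>. Fav (rand_set L \<omega> n))) \<longlonglongrightarrow> 1"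
proof -
  obtain K where K: "0 < K" "\<And>n. expectation (\<lambda>\<omega>. (F n \<omega>)\<^sup>2) \<le> K * (m n)\<^sup>2"
    by (rule second_moment_le[of "\<lambda>n. expectation (\<lambda>\<omega>. (F n \<omega>)\<^sup>2)", OF second_moment_F_Suc_le]) blast
  have "0 < sqrt K" using K by simp
  then obtain C where C: "\<forall>\<^sub>F n in sequentially. expectation (\<lambda>\<omega>. \<bar>F n \<omega> - m n\<bar>) \<le> C * sqrt (\<beta> n) * m n"
    by (rule deviation_le[OF _ deviation_F_le[OF K(2,1)]]) blast
  have mono: "AE \<omega> in grid_space X. \<forall>n. 0 \<le> F n \<omega> \<and> F (Suc n) \<omega> \<le> F n \<omega>"
    using AE_good by eventually_elim (simp add: F_nonneg, simp add: F_good Fav_antimono[OF _ L_pos])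
  have "AE \<omega> in grid_space X. (\<lambda>n. F n \<omega> / m n) \<longlonglongrightarrow> 1"
    by (rule AE_ratio_tendsto_1[OF convex_decay_m bounded_rv_integrable[OF bounded_rv_F] mono C])
  then show ?thesis using AE_good
    by eventually_elim (simp add: expectation_Fav F_good)
qed

end

theorem theorem1p2:
  fixes L :: nat and X :: "(nat \<times> nat) set pmf"
  assumes "L \<ge> 2"
    and "grid_model L X"
    and "ahlfors_regular L X"
    and "uniform_model L X"
  shows "AE \<omega> in grid_space X.
     (\<lambda>n. Fav (rand_set L \<omega> n) /
           (\<integral>\<omega>'. Fav (rand_set L \<omega>' n) \<partial>grid_space X)) \<longlonglongrightarrow> 1"
proof -
  interpret regular_grid_model L X
    using assms(1-3) by unfold_locales
      (auto simp: grid_model_def ahlfors_regular_def AE_measure_pmf_iff)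
  show ?thesis by (rule Fav_ratio_tendsto)
qed

end
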